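(* Let $\alpha,\beta\ge 0$ with $\alpha+\beta>0$. Let $u_0:\mathbb{R}\to[0,1]$ be a piecewise continuous function and let $\{\mu^n\}_{n\in\mathbb{N}}$ be the sequence of Bernoulli product measures associated to the profile $u_0$. Assume that there exists a constant $\rho\in(0,1)$ such that $$\sup_n \frac1n\sum_{x\in\mathbb{Z}}\big|u_0(\tfrac{x}{n})-\rho\big|^2<+\infty.$$ Fix $T>0$, let $\{\xi^n_t;t\in[0,T]\}$ be the rescaled environment as seen by the walker with initial distribution $\mu^n$, and let $\mathbb{E}^n$ denote expectation with respect to its law. Then, for every $t\in[0,T]$, $$\lim_{\epsilon\to0}\limsup_{n\to\infty}\mathbb{E}^n\left[\left|\int_0^t\Big(\xi^n_s(0)-\frac{1}{\epsilon n}\sum_{z=1}^{\epsilon n}\xi^n_s(z)\Big)ds\right|\right]=0.$$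
   Context: Let $\Omega=\{0,1\}^{\mathbb{Z}}$. For $\xi\in\Omega$ and $z\in\mathbb{Z}$, $\xi^{z,z+1}$ is the configuration obtained from $\xi$ by exchanging the values $\xi(z)$ and $\xi(z+1)$, and $\theta^z$ is the shift $(\theta^z\xi)(x)=\xi(x+z)$. A function on $\Omega$ is local if it depends on finitely many coordinates. Jump rates: $c_{+1}(a)=\beta+(\alpha-\beta)a$ and $c_{-1}(a)=\alpha+(\beta-\alpha)a$ for $a\in\{0,1\}$. The rescaled environment as seen by the walker $\{\xi^n_t;t\ge0\}$ is the Markov process on $\Omega$ with generator $$\mathcal{L}_nf(\xi)=n^2\sum_{z\in\mathbb{Z}}\big[f(\xi^{z,z+1})-f(\xi)\big]+n\sum_{y\in\{\pm1\}}c_y(\xi(0))\big[f(\theta^y\xi)-f(\xi)\big]$$ for local $f:\Omega\to\mathbb{R}$. The Bernoulli product measure $\mu^n$ associated to the profile $u_0$ is the probability measure on $\Omega$ with $\mu^n(\eta(z_1)=1,\dots,\eta(z_\ell)=1)=\prod_{i=1}^\ell u_0(z_i/n)$ for any set $\{z_1,\dots,z_\ell\}\subseteq\mathbb{Z}$ (of distinct sites). For $\epsilon>0$ and $n\in\mathbb{N}$, $\epsilon n$ is used indistinctly for the real number $\epsilon n$ and for its integer part $\lfloor\epsilon n\rfloor$. *)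

theory Defs
  imports "HOL-Probability.Probability"
begin

section \<open>Markov processes specified by a pregenerator\<close>

text \<open>Semigroups act on the Banach space of bounded continuous real functions on the state space;
  for a compact state space these are all the continuous functions, with the supremum norm.\<close>

definition markov_semigroup ::
    "(real \<Rightarrow> ('a::topological_space \<Rightarrow>\<^sub>C real) \<Rightarrow> ('a \<Rightarrow>\<^sub>C real)) \<Rightarrow> bool" where
  "markov_semigroup S \<longleftrightarrow>
     (\<forall>t\<ge>0. linear (S t)) \<and>
     (\<forall>f. S 0 f = f) \<and>
     (\<forall>s\<ge>0. \<forall>t\<ge>0. \<forall>f. S (s + t) f = S s (S t f)) \<and>
     (\<forall>t\<ge>0. S t (const_bcontfun 1) = const_bcontfun 1) \<and>
     (\<forall>t\<ge>0. \<forall>f. (\<forall>x. 0 \<le> apply_bcontfun f x) \<longrightarrow> (\<forall>x. 0 \<le> apply_bcontfun (S t f) x)) \<and>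
     (\<forall>f. \<forall>t\<ge>0. ((\<lambda>s. S s f) \<longlongrightarrow> S t f) (at_right t))"

text \<open>The infinitesimal generator, as the graph of an unbounded operator.\<close>

definition semigroup_generator ::
    "(real \<Rightarrow> ('a::topological_space \<Rightarrow>\<^sub>C real) \<Rightarrow> ('a \<Rightarrow>\<^sub>C real)) \<Rightarrow>
      (('a \<Rightarrow>\<^sub>C real) \<times> ('a \<Rightarrow>\<^sub>C real)) set" where
  "semigroup_generator S = {(f, g). ((\<lambda>t. (S t f - f) /\<^sub>R t) \<longlongrightarrow> g) (at_right 0)}"

definition cadlag :: "(real \<Rightarrow> 'a::topological_space) \<Rightarrow> bool" where
  "cadlag p \<longleftrightarrow>
     (\<forall>t\<ge>0. (p \<longlongrightarrow> p t) (at_right t)) \<and> (\<forall>t>0. \<exists>l. (p \<longlongrightarrow> l) (at_left t))"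

definition past :: "'w measure \<Rightarrow> (real \<Rightarrow> 'w \<Rightarrow> 'a::topological_space) \<Rightarrow> real \<Rightarrow> 'w measure" where
  "past M X s = sigma (space M) {X r -` A \<inter> space M | r A. 0 \<le> r \<and> r \<le> s \<and> A \<in> sets borel}"

definition markov_with_semigroup ::
    "(real \<Rightarrow> ('a::topological_space \<Rightarrow>\<^sub>C real) \<Rightarrow> ('a \<Rightarrow>\<^sub>C real)) \<Rightarrow>
      'w measure \<Rightarrow> (real \<Rightarrow> 'w \<Rightarrow> 'a) \<Rightarrow> bool" where
  "markov_with_semigroup S M X \<longleftrightarrow>
     (\<forall>s\<ge>0. \<forall>t\<ge>0. \<forall>f. AE w in M.
        real_cond_exp M (past M X s) (\<lambda>w. apply_bcontfun f (X (s + t) w)) w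
          = apply_bcontfun (S t f) (X s w))"

text \<open>\<open>G\<close> is the graph of an operator defined on a core: the generator of the semigroup
  of the process is the closure of \<open>G\<close> in the product of the two Banach spaces.\<close>

definition markov_process_with_generator ::
    "(('a::topological_space \<Rightarrow>\<^sub>C real) \<times> ('a \<Rightarrow>\<^sub>C real)) set \<Rightarrow> 'a measure \<Rightarrow>
      'w measure \<Rightarrow> (real \<Rightarrow> 'w \<Rightarrow> 'a) \<Rightarrow> bool" where
  "markov_process_with_generator G \<mu> M X \<longleftrightarrow>
     prob_space M \<and>
     (\<forall>t\<ge>0. X t \<in> borel_measurable M) \<and>
     (\<forall>w\<in>space M. cadlag (\<lambda>t. X t w)) \<and>
     distr M borel (X 0) = \<mu> \<and>
     (\<exists>S. markov_semigroup S \<and> semigroup_generator S = closure G \<and> markov_with_semigroup S M X)"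


section \<open>The environment as seen by the walker\<close>

text \<open>\<open>True\<close> encodes an occupied site (value 1); the space carries the product topology.\<close>

type_synonym config = "int \<Rightarrow> bool"

definition exchange :: "int \<Rightarrow> config \<Rightarrow> config" where
  "exchange z \<xi> = \<xi>(z := \<xi> (z + 1), z + 1 := \<xi> z)"

definition shift_config :: "int \<Rightarrow> config \<Rightarrow> config" where
  "shift_config z \<xi> = (\<lambda>x. \<xi> (x + z))"

definition local_function :: "(config \<Rightarrow> real) \<Rightarrow> bool" where
  "local_function f \<longleftrightarrow>
     (\<exists>A. finite A \<and> (\<forall>\<xi> \<eta>. (\<forall>x\<in>A. \<xi> x = \<eta> x) \<longrightarrow> f \<xi> = f \<eta>))"

definition jump_rate :: "real \<Rightarrow> real \<Rightarrow> int \<Rightarrow> real \<Rightarrow> real" where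
  "jump_rate \<alpha> \<beta> y a = (if y = 1 then \<beta> + (\<alpha> - \<beta>) * a else \<alpha> + (\<beta> - \<alpha>) * a)"

text \<open>For a local function only finitely many terms of the infinite sum are nonzero.\<close>

definition env_generator ::
    "real \<Rightarrow> real \<Rightarrow> nat \<Rightarrow> (config \<Rightarrow> real) \<Rightarrow> config \<Rightarrow> real" where
  "env_generator \<alpha> \<beta> n f \<xi> =
     (real n)\<^sup>2 * (\<Sum>\<^sub>\<infinity>z\<in>UNIV. f (exchange z \<xi>) - f \<xi>) +
     real n * (\<Sum>y\<in>{1, -1}. jump_rate \<alpha> \<beta> y (of_bool (\<xi> 0)) * (f (shift_config y \<xi>) - f \<xi>))"

definition env_pregenerator ::
    "real \<Rightarrow> real \<Rightarrow> nat \<Rightarrow> ((config \<Rightarrow>\<^sub>C real) \<times> (config \<Rightarrow>\<^sub>C real)) set" where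
  "env_pregenerator \<alpha> \<beta> n =
     {(f, g). local_function (apply_bcontfun f) \<and>
              apply_bcontfun g = env_generator \<alpha> \<beta> n (apply_bcontfun f)}"

definition bernoulli_profile :: "(real \<Rightarrow> real) \<Rightarrow> nat \<Rightarrow> config measure" where
  "bernoulli_profile u n =
     (\<Pi>\<^sub>M z\<in>UNIV. measure_pmf (bernoulli_pmf (u (real_of_int z / real n))))"

definition piecewise_continuous :: "(real \<Rightarrow> real) \<Rightarrow> bool" where
  "piecewise_continuous u \<longleftrightarrow>
     (\<forall>a b. finite {x \<in> {a..b}. \<not> isCont u x}) \<and>
     (\<forall>x. (\<exists>l. (u \<longlongrightarrow> l) (at_left x)) \<and> (\<exists>r. (u \<longlongrightarrow> r) (at_right x)))"


section \<open>Consistency of the definitions\<close>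

lemma bernoulli_profile_cylinder:
  assumes u: "\<And>x. u x \<in> {0..1}" and Z: "finite Z"
  shows "measure (bernoulli_profile u n) {\<eta>. \<forall>z\<in>Z. \<eta> z} = (\<Prod>z\<in>Z. u (real_of_int z / real n))"
proof -
  let ?P = "\<lambda>z::int. measure_pmf (bernoulli_pmf (u (real_of_int z / real n)))"
  interpret product_prob_space ?P UNIV
    by unfold_locales
  have "emeasure (Pi\<^sub>M UNIV ?P) {\<eta> \<in> space (Pi\<^sub>M UNIV ?P). \<forall>z\<in>Z. \<eta> z \<in> {True}}
      = (\<Prod>z\<in>Z. emeasure (?P z) {True})"
    by (rule emeasure_PiM_Collect) (use Z in auto)
  also have "\<dots> = (\<Prod>z\<in>Z. ennreal (u (real_of_int z / real n)))"
    using u by (intro prod.cong refl) (simp add: emeasure_pmf_single)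
  also have "\<dots> = ennreal (\<Prod>z\<in>Z. u (real_of_int z / real n))"
    using u by (intro prod_ennreal) auto
  finally show ?thesis
    using u by (simp add: bernoulli_profile_def measure_def space_PiM prod_nonneg)
qed

instance bool :: second_countable_topology
proof
  show "\<exists>B::bool set set. countable B \<and> open = generate_topology B"
  proof (intro exI conjI)
    show "countable (UNIV :: bool set set)"
      by (rule countable_finite) (rule finite)
    show "open = generate_topology (UNIV :: bool set set)"
      by (intro ext) (simp add: Topological_Spaces.open_discrete generate_topology.Basis)
  qed
qed

lemma sets_bernoulli_profile: "sets (bernoulli_profile u n) = sets borel"
proof -
  have "sets (borel :: bool measure) = UNIV"
    using borel_open[OF Topological_Spaces.open_discrete] by blast
  then have "sets (bernoulli_profile u n) = sets (\<Pi>\<^sub>M z\<in>(UNIV::int set). (borel :: bool measure))"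
    unfolding bernoulli_profile_def by (intro sets_PiM_cong) auto
  then show ?thesis
    by (simp add: sets_PiM_equal_borel)
qed

lemma prob_space_bernoulli_profile: "prob_space (bernoulli_profile u n)"
  unfolding bernoulli_profile_def by (intro prob_space_PiM) (rule prob_space_measure_pmf)

lemma local_function_bcontfun:
  assumes "local_function f"
  shows "f \<in> bcontfun"
proof -
  obtain A where A: "finite A" and f: "\<And>\<xi> \<eta>. (\<forall>x\<in>A. \<xi> x = \<eta> x) \<Longrightarrow> f \<xi> = f \<eta>"
    using assms unfolding local_function_def by blast
  have "open (f -` S)" for S
  proof (subst open_subopen, intro ballI)
    fix \<xi> assume "\<xi> \<in> f -` S"
    let ?U = "\<Inter>x\<in>A. (\<lambda>\<eta> :: config. \<eta> x) -` {\<xi> x}"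
    have "open ?U"
      using A by (intro open_INT ballI open_vimage Topological_Spaces.open_discrete continuous_on_product_coordinates)
    moreover have "\<xi> \<in> ?U"
      by simp
    moreover have "?U \<subseteq> f -` S"
    proof
      fix \<eta> assume "\<eta> \<in> ?U"
      then have "f \<eta> = f \<xi>"
        by (intro f) simp
      with \<open>\<xi> \<in> f -` S\<close> show "\<eta> \<in> f -` S"
        by simp
    qed
    ultimately show "\<exists>U. open U \<and> \<xi> \<in> U \<and> U \<subseteq> f -` S"
      by blast
  qed
  then have "continuous_on UNIV f"
    by (subst continuous_on_open_vimage[OF open_UNIV]) (simp only: Int_UNIV_right, blast)
  moreover have "range f \<subseteq> (\<lambda>B. f (\<lambda>x. x \<in> B)) ` Pow A"
  proof
    fix y assume "y \<in> range f"
    then obtain \<xi> where "y = f \<xi>" by auto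
    also have "f \<xi> = f (\<lambda>x. x \<in> {x \<in> A. \<xi> x})"
      by (rule f) auto
    finally show "y \<in> (\<lambda>B. f (\<lambda>x. x \<in> B)) ` Pow A" by blast
  qed
  then have "bounded (range f)"
    using A by (meson finite_Pow_iff finite_imageI finite_imp_bounded finite_subset)
  ultimately show ?thesis
    by (simp add: bcontfun_def)
qed

lemma local_function_env_generator:
  assumes "local_function f"
  shows "local_function (env_generator \<alpha> \<beta> n f)"
proof -
  obtain A where A: "finite A" and f: "\<And>\<xi> \<eta>. (\<forall>x\<in>A. \<xi> x = \<eta> x) \<Longrightarrow> f \<xi> = f \<eta>"
    using assms unfolding local_function_def by blast
  define B where "B = insert 0 (A \<union> (\<lambda>x. x + 1) ` A \<union> (\<lambda>x. x - 1) ` A)"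
  have "finite B"
    using A by (simp add: B_def)
  moreover have "env_generator \<alpha> \<beta> n f \<xi> = env_generator \<alpha> \<beta> n f \<eta>"
    if B: "\<forall>x\<in>B. \<xi> x = \<eta> x" for \<xi> \<eta>
  proof -
    have eq: "\<xi> x = \<eta> x" "\<xi> (x + 1) = \<eta> (x + 1)" "\<xi> (x - 1) = \<eta> (x - 1)" if "x \<in> A" for x
      using that B by (auto simp: B_def)
    have 1: "f \<xi> = f \<eta>" and 2: "f (shift_config 1 \<xi>) = f (shift_config 1 \<eta>)"
      and 3: "f (shift_config (-1) \<xi>) = f (shift_config (-1) \<eta>)"
      using eq by (auto intro!: f simp: shift_config_def)
    have 4: "f (exchange z \<xi>) = f (exchange z \<eta>)" for z
      using eq eq(3)[of "z + 1"] by (intro f) (auto simp: exchange_def)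
    have "\<xi> 0 = \<eta> 0"
      using B by (simp add: B_def)
    then show ?thesis
      by (simp add: env_generator_def 1 2 3 4)
  qed
  ultimately show ?thesis
    unfolding local_function_def by blast
qed

lemma env_pregenerator_total:
  assumes "local_function f"
  shows "(Bcontfun f, Bcontfun (env_generator \<alpha> \<beta> n f)) \<in> env_pregenerator \<alpha> \<beta> n"
  unfolding env_pregenerator_def
  using assms local_function_bcontfun[OF assms]
    local_function_bcontfun[OF local_function_env_generator[OF assms]]
  by (auto simp only: mem_Collect_eq case_prod_conv Bcontfun_inverse)

end

theory Submission
  imports Defs
begin

text \<open>
  Occupation variables are linear observables, and on linear observables the symmetric exclusion
  dynamics acts as the discrete Laplacian. With \<open>k = \<lfloor>\<epsilon> n\<rfloor>\<close>, the observable
  \<open>V(\<xi>) = \<xi>(0) - (1/k) \<Sum>\<^bsub>z=1..k\<^esub> \<xi>(z)\<close> has total mass zero, so the discrete Poisson equation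
  \<open>\<Delta> \<phi> = \<delta>\<^sub>0 - (1/k) 1\<^bsub>{1..k}\<^esub>\<close> has a solution whose gradient is bounded by 1 and supported on
  \<open>{0..<k}\<close>. Letting \<open>\<phi>\<close> return to 0 linearly over \<open>n\<close> further sites on the left makes it finitely
  supported, at the price of a defect of order \<open>k/n \<le> \<epsilon>\<close> in the equation.

  Let \<open>f(\<xi>) = (1/n\<^sup>2) \<Sum>\<^sub>x \<phi>(x) \<xi>(x)\<close>. Since \<open>\<phi>\<close> is of order \<open>\<epsilon> n\<close> on a window of order \<open>n\<close> sites,
  \<open>f\<close> is of order \<open>\<epsilon>\<close>. The exclusion part of the generator maps \<open>f\<close> to \<open>V\<close> up to the defect. A jump
  of the walker shifts the configuration and changes \<open>f\<close> by at most \<open>1/n\<^sup>2\<close> times the total variation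
  of \<open>\<phi>\<close>, that is by \<open>O(\<epsilon>/n)\<close>; at rate of order \<open>n\<close> this is again \<open>O(\<epsilon>)\<close>. All these bounds are
  uniform over configurations (\<open>environment_corrector\<close>), so they hold along every path.

  By Dynkin's formula \<open>\<integral> V(\<xi> s) ds\<close> therefore equals an increment of \<open>f\<close> minus a martingale, up to
  \<open>O(\<epsilon>)\<close>. The second moment of the martingale is the time integral of the carre du champ of \<open>f\<close>
  (\<open>dynkin_martingale_variance\<close>), which is of order \<open>1/n\<close>. Hence the expectation is at most
  \<open>C \<epsilon> + C / sqrt n\<close> (\<open>replacement_bound\<close>).

  The process is given through a semigroup whose generator is the closure of the pregenerator, so
  every local function and its square lie in the domain of the generator. Differentiability of the
  semigroup on that domain and the Markov property of two-time correlations then give the Dynkin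
  formula.
\<close>


section \<open>Differentiability of Markov semigroups\<close>

text \<open>Positivity applied to \<open>norm f \<plusminus> f \<ge> 0\<close>, together with conservation of constants.\<close>

lemma markov_semigroup_contraction:
  fixes f :: "'a::topological_space \<Rightarrow>\<^sub>C real"
  assumes S: "markov_semigroup S" and t: "t \<ge> 0"
  shows "norm (S t f) \<le> norm f"
proof (rule norm_bound)
  fix x
  let ?one = "const_bcontfun 1 :: 'a \<Rightarrow>\<^sub>C real"
  have lin: "linear (S t)" and one: "S t ?one = ?one"
    and pos: "(\<forall>x. 0 \<le> apply_bcontfun h x) \<Longrightarrow> 0 \<le> apply_bcontfun (S t h) x" for h
    using S t unfolding markov_semigroup_def by auto
  have f: "\<bar>apply_bcontfun f y\<bar> \<le> norm f" for y
    using norm_bounded[of f y] by simp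
  have "0 \<le> apply_bcontfun (S t (norm f *\<^sub>R ?one - f)) x"
    by (rule pos) (use f in \<open>auto simp: abs_le_iff\<close>)
  moreover have "0 \<le> apply_bcontfun (S t (norm f *\<^sub>R ?one + f)) x"
    by (rule pos) (use f in \<open>auto simp: abs_le_iff algebra_simps, smt (verit)\<close>)
  ultimately show "norm (apply_bcontfun (S t f) x) \<le> norm f"
    by (simp add: linear_diff[OF lin] linear_add[OF lin] linear_scale[OF lin] one)
qed

text \<open>The generator is a right derivative at time 0, and strong continuity is one-sided. The
  contraction property upgrades both: \<open>S t f\<close> is differentiable from both sides, so the fundamental
  theorem of calculus applies to it.\<close>

lemma semigroup_has_vector_derivative:
  fixes f g :: "'a::topological_space \<Rightarrow>\<^sub>C real"
  assumes S: "markov_semigroup S" and fg: "(f, g) \<in> semigroup_generator S" and t: "t \<ge> 0"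
  shows "((\<lambda>s. S s f) has_vector_derivative S t g) (at t within {0..})"
  unfolding has_vector_derivative_def has_derivative_within_alt
proof (intro conjI allI impI)
  show "bounded_linear (\<lambda>h. h *\<^sub>R S t g)"
    by (rule bounded_linear_scaleR_left)
next
  fix e :: real assume e: "e > 0"
  have lin: "linear (S s)" if "s \<ge> 0" for s
    using S that unfolding markov_semigroup_def by auto
  have add: "S (s + r) h = S s (S r h)" if "s \<ge> 0" "r \<ge> 0" for s r h
    using S that unfolding markov_semigroup_def by auto
  have contr: "norm (S s h) \<le> norm h" if "s \<ge> 0" for s h
    using markov_semigroup_contraction[OF S that] .
  have "((\<lambda>s. (S s f - f) /\<^sub>R s) \<longlongrightarrow> g) (at_right 0)"
    using fg by (simp add: semigroup_generator_def)
  from tendstoD[OF this, of "e / 2"] e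
  have 1: "eventually (\<lambda>s. dist ((S s f - f) /\<^sub>R s) g < e / 2) (at_right 0)"
    by simp
  have "S 0 g = g"
    using S unfolding markov_semigroup_def by blast
  moreover have "((\<lambda>s. S s g) \<longlongrightarrow> S 0 g) (at_right 0)"
    using S unfolding markov_semigroup_def by blast
  ultimately have "((\<lambda>s. S s g) \<longlongrightarrow> g) (at_right 0)"
    by simp
  from tendstoD[OF this, of "e / 2"] e
  have 2: "eventually (\<lambda>s. dist (S s g) g < e / 2) (at_right 0)"
    by simp
  from eventually_conj[OF 1 2] obtain d where d: "d > 0"
    and d1: "\<And>h. 0 < h \<Longrightarrow> h < d \<Longrightarrow> dist ((S h f - f) /\<^sub>R h) g < e / 2"
    and d2: "\<And>h. 0 < h \<Longrightarrow> h < d \<Longrightarrow> dist (S h g) g < e / 2"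
    unfolding eventually_at_right_field by auto
  \<comment> \<open>Both one-sided difference quotients reduce to the one at time 0 by the semigroup property;
    from the left there remains the oscillation of \<open>S s g\<close> over the time step.\<close>
  have inc: "norm (S (a + h) f - S a f - h *\<^sub>R S a g) \<le> h * (e / 2)"
    if "a \<ge> 0" "0 < h" "h < d" for a h
  proof -
    have "S (a + h) f - S a f - h *\<^sub>R S a g = S a (S h f - f - h *\<^sub>R g)"
      using that by (simp add: add linear_diff[OF lin] linear_scale[OF lin])
    also have "norm \<dots> \<le> norm (S h f - f - h *\<^sub>R g)"
      by (rule contr[OF that(1)])
    also have "S h f - f - h *\<^sub>R g = h *\<^sub>R ((S h f - f) /\<^sub>R h - g)"
      using that by (simp add: scaleR_diff_right)
    also have "norm \<dots> \<le> h * (e / 2)"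
      using d1[OF that(2,3)] that by (simp add: dist_norm)
    finally show ?thesis .
  qed
  show "\<exists>d>0. \<forall>y\<in>{0..}. norm (y - t) < d \<longrightarrow>
      norm (S y f - S t f - (y - t) *\<^sub>R S t g) \<le> e * norm (y - t)"
  proof (intro exI[of _ d] conjI ballI impI d)
    fix y assume y: "y \<in> {0..}" and yd: "norm (y - t) < d"
    consider "y = t" | "y > t" | "y < t" by linarith
    then show "norm (S y f - S t f - (y - t) *\<^sub>R S t g) \<le> e * norm (y - t)"
    proof cases
      case 1 then show ?thesis by simp
    next
      case 2
      have "norm (S y f - S t f - (y - t) *\<^sub>R S t g) \<le> (y - t) * (e / 2)"
        using inc[of t "y - t"] 2 yd t by simp
      also have "\<dots> \<le> (y - t) * e"
        using 2 e by (intro mult_left_mono) auto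
      finally show ?thesis
        using 2 by (simp add: mult.commute)
    next
      case 3
      define h where "h = t - y"
      have h: "0 < h" "h < d" and ty: "t = y + h" and y0: "y \<ge> 0"
        using 3 yd y by (auto simp: h_def)
      have "S t g - S y g = S y (S h g - g)"
        using h y0 by (simp add: ty add linear_diff[OF lin])
      then have A: "norm (S t g - S y g) \<le> e / 2"
        using contr[OF y0, of "S h g - g"] d2[OF h] by (simp add: dist_norm)
      have "S y f - S t f - (y - t) *\<^sub>R S t g
          = - (S (y + h) f - S y f - h *\<^sub>R S y g) + h *\<^sub>R (S t g - S y g)"
        by (simp add: ty algebra_simps)
      also have "norm \<dots> \<le> h * (e / 2) + h * (e / 2)"
      proof (rule order_trans[OF norm_triangle_ineq], rule add_mono)
        show "norm (- (S (y + h) f - S y f - h *\<^sub>R S y g)) \<le> h * (e / 2)"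
          using inc[OF y0 h] by (simp only: norm_minus_cancel)
        show "norm (h *\<^sub>R (S t g - S y g)) \<le> h * (e / 2)"
          using A h by simp
      qed
      finally show ?thesis
        using h by (simp add: ty mult.commute)
    qed
  qed
qed


section \<open>Time integrals along a Markov process\<close>

text \<open>Both orderings of the two time variables contribute equally to the square by Fubini,
  and the diagonal is a null set. In this form the later increment of the integral can be
  averaged first, by the Markov property.\<close>

lemma square_time_integral:
  fixes g :: "real \<Rightarrow> real"
  assumes [measurable]: "g \<in> borel_measurable borel" and C: "\<And>s. \<bar>g s\<bar> \<le> C"
  shows "(LBINT s:{0..t}. g s)\<^sup>2 = 2 * (LBINT s:{0..t}. g s * (LBINT r:{s..t}. g r))"
proof -
  let ?G = "\<lambda>s. indicator {0..t} s * g s"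
  have C0: "C \<ge> 0" using C[of 0] by linarith
  have "integrable lborel (indicator {0..t} :: real \<Rightarrow> real)"
    by (rule integrable_real_indicator) (auto simp: emeasure_lborel_Icc_eq)
  then have "integrable lborel (\<lambda>s. indicator {0..t} s * C)"
    by simp
  then have I: "integrable lborel ?G"
    by (rule Bochner_Integration.integrable_bound)
       (use C C0 in \<open>auto simp: abs_mult split: split_indicator\<close>)
  have I2: "integrable (lborel \<Otimes>\<^sub>M lborel) (\<lambda>(s, r). ?G s * ?G r)"
  proof (rule integrableI_bounded_set[of "{0..t} \<times> {0..t}" _ _ "C * C"])
    show "emeasure (lborel \<Otimes>\<^sub>M lborel) ({0..t} \<times> {0..t}) < \<infinity>"
      by (subst lborel.emeasure_pair_measure_Times)
         (auto simp: emeasure_lborel_Icc_eq ennreal_mult_less_top)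
    show "AE x in lborel \<Otimes>\<^sub>M lborel. x \<in> {0..t} \<times> {0..t} \<longrightarrow>
        norm (case x of (s, r) \<Rightarrow> ?G s * ?G r) \<le> C * C"
      using C C0 by (auto simp: abs_mult intro!: AE_I2 mult_mono)
  qed (auto intro!: AE_I2 simp: indicator_def)
  define K where "K = (\<lambda>s r. of_bool (s \<le> r) * (?G s * ?G r))"
  have K: "integrable (lborel \<Otimes>\<^sub>M lborel) (case_prod K)"
    by (rule Bochner_Integration.integrable_bound[OF I2]) (auto simp: K_def)
  have K_int: "integrable lborel (K s)" for s
    unfolding K_def
    by (rule Bochner_Integration.integrable_bound[of _ "\<lambda>r. ?G s * ?G r"])
       (use I in auto)
  have K_int': "integrable lborel (\<lambda>r. K r s)" for s
    unfolding K_def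
    by (rule Bochner_Integration.integrable_bound[of _ "\<lambda>r. ?G s * ?G r"])
       (use I in \<open>auto intro!: AE_I2 simp: mult.commute\<close>)
  have "(LBINT s:{0..t}. g s)\<^sup>2 = (\<integral>s. ?G s * (\<integral>r. ?G r \<partial>lborel) \<partial>lborel)"
    by (simp add: set_lebesgue_integral_def power2_eq_square)
  also have "\<dots> = (\<integral>s. (\<integral>r. K s r \<partial>lborel) + (\<integral>r. K r s \<partial>lborel) \<partial>lborel)"
  proof (rule Bochner_Integration.integral_cong[OF refl])
    fix s
    have "?G s * (\<integral>r. ?G r \<partial>lborel) = (\<integral>r. ?G s * ?G r \<partial>lborel)"
      by simp
    also have "\<dots> = (\<integral>r. K s r + K r s \<partial>lborel)"
      by (rule integral_cong_AE) (use AE_lborel_singleton[of s] in \<open>auto simp: K_def\<close>)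
    finally show "?G s * (\<integral>r. ?G r \<partial>lborel) = (\<integral>r. K s r \<partial>lborel) + (\<integral>r. K r s \<partial>lborel)"
      using K_int K_int' by simp
  qed
  also have "\<dots> = (\<integral>s. (\<integral>r. K s r \<partial>lborel) \<partial>lborel) + (\<integral>s. (\<integral>r. K r s \<partial>lborel) \<partial>lborel)"
    by (intro Bochner_Integration.integral_add lborel_pair.integrable_fst lborel_pair.integrable_snd K)
  also have "(\<integral>s. (\<integral>r. K r s \<partial>lborel) \<partial>lborel) = (\<integral>s. (\<integral>r. K s r \<partial>lborel) \<partial>lborel)"
    by (rule lborel_pair.Fubini_integral[OF K])
  also have "(\<integral>s. (\<integral>r. K s r \<partial>lborel) \<partial>lborel) = (LBINT s:{0..t}. g s * (LBINT r:{s..t}. g r))"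
    unfolding set_lebesgue_integral_def
  proof (rule Bochner_Integration.integral_cong[OF refl])
    fix s
    have "(\<integral>r. K s r \<partial>lborel) = (\<integral>r. ?G s * (indicator {s..t} r * g r) \<partial>lborel)"
      by (rule Bochner_Integration.integral_cong[OF refl]) (auto simp: K_def split: split_indicator)
    then show "(\<integral>r. K s r \<partial>lborel)
        = indicator {0..t} s *\<^sub>R (g s * (\<integral>r. indicator {s..t} r *\<^sub>R g r \<partial>lborel))"
      by simp
  qed
  finally show ?thesis by simp
qed

text \<open>The semigroup is a parameter here, so that it can be referred to by name; for a process with
  a given generator it is only known to exist.\<close>

locale markov_process = prob_space M for M :: "'w measure" +
  fixes S :: "real \<Rightarrow> ('a::topological_space \<Rightarrow>\<^sub>C real) \<Rightarrow> ('a \<Rightarrow>\<^sub>C real)"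
    and X :: "real \<Rightarrow> 'w \<Rightarrow> 'a"
  assumes X_measurable: "t \<ge> 0 \<Longrightarrow> X t \<in> borel_measurable M"
    and cadlag_paths: "w \<in> space M \<Longrightarrow> cadlag (\<lambda>t. X t w)"
    and semigroup: "markov_semigroup S"
    and markov: "markov_with_semigroup S M X"
begin

text \<open>Freezing the path before time 0 makes \<open>obs h\<close> right-continuous on the whole real line, so
  that it is jointly measurable in time and randomness without restricting the time axis.\<close>

definition obs :: "('a \<Rightarrow>\<^sub>C real) \<Rightarrow> real \<Rightarrow> 'w \<Rightarrow> real" where
  "obs h s w = apply_bcontfun h (X (max 0 s) w)"

lemma obs_nonneg_time: "s \<ge> 0 \<Longrightarrow> obs h s w = apply_bcontfun h (X s w)"
  by (simp add: obs_def)

lemma abs_obs_le: "\<bar>obs h s w\<bar> \<le> norm h"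
  using norm_bounded[of h "X (max 0 s) w"] by (simp add: obs_def)

lemma obs_fixed_time_measurable: "obs h c \<in> borel_measurable M"
  unfolding obs_def
  by (rule measurable_compose[OF X_measurable borel_measurable_continuous_onI]) auto

lemma obs_right_limit:
  assumes w: "w \<in> space M"
  shows "((\<lambda>r. obs h r w) \<longlongrightarrow> obs h s w) (at_right s)"
proof (cases "s \<ge> 0")
  case True
  have "((\<lambda>r. X r w) \<longlongrightarrow> X s w) (at_right s)"
    using cadlag_paths[OF w] True unfolding cadlag_def by blast
  then have "((\<lambda>r. apply_bcontfun h (X r w)) \<longlongrightarrow> apply_bcontfun h (X s w)) (at_right s)"
    by (rule continuous_on_tendsto_compose[OF continuous_on_apply_bcontfun[of UNIV]]) auto
  moreover have "\<forall>\<^sub>F r in at_right s. apply_bcontfun h (X r w) = obs h r w"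
    using True by (auto simp: obs_def eventually_at_right_field intro!: exI[of _ "s + 1"])
  ultimately show ?thesis
    using True by (simp add: obs_nonneg_time tendsto_cong)
next
  case False
  have "\<forall>\<^sub>F r in at_right s. obs h s w = obs h r w"
    using False by (auto simp: obs_def eventually_at_right_field intro!: exI[of _ 0])
  then show ?thesis
    using tendsto_const tendsto_cong by fast
qed

text \<open>By right-continuity the path is the limit of step processes which take the value at the next
  point of the grid of mesh \<open>1 / (m + 1)\<close>; each of these is measurable because the grid is countable.\<close>

lemma obs_jointly_measurable:
  "(\<lambda>(s, w). obs h s w) \<in> borel_measurable (borel \<Otimes>\<^sub>M M)"
proof -
  define a where "a = (\<lambda>m (s::real). (of_int \<lfloor>real (Suc m) * s\<rfloor> + 1) / real (Suc m))"
  have "(\<lambda>x. obs h (a m (fst x)) (snd x)) \<in> borel_measurable (borel \<Otimes>\<^sub>M M)" for m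
    unfolding a_def
    by (rule measurable_compose_countable[where
          f = "\<lambda>i x. obs h ((of_int i + 1) / real (Suc m)) (snd x)"])
       (auto intro: measurable_compose[OF measurable_snd obs_fixed_time_measurable])
  moreover have "(\<lambda>m. obs h (a m s) w) \<longlonglongrightarrow> obs h s w" if "w \<in> space M" for s w
  proof (rule filterlim_compose[OF obs_right_limit[OF that]])
    have gt: "a m s > s" for m
      unfolding a_def by (simp add: field_simps del: of_nat_Suc) linarith
    have le: "a m s \<le> s + inverse (real (Suc m))" for m
      unfolding a_def by (simp add: field_simps del: of_nat_Suc)
    have "(\<lambda>m. a m s) \<longlonglongrightarrow> s"
      by (rule tendsto_sandwich[OF _ _ tendsto_const LIMSEQ_inverse_real_of_nat_add])
         (use less_imp_le[OF gt] le in \<open>simp_all del: of_nat_Suc\<close>)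
    moreover have "\<forall>\<^sub>F m in sequentially. a m s \<in> {s<..} \<and> a m s \<noteq> s"
      using gt by (intro always_eventually) (metis greaterThan_iff less_irrefl)
    ultimately show "filterlim (\<lambda>m. a m s) (at_right s) sequentially"
      unfolding filterlim_at by blast
  qed
  ultimately show ?thesis
    by (elim borel_measurable_LIMSEQ_real[rotated]) (auto simp: space_pair_measure)
qed

lemma obs_measurable [measurable (raw)]:
  assumes "f \<in> borel_measurable N" and "g \<in> N \<rightarrow>\<^sub>M M"
  shows "(\<lambda>x. obs h (f x) (g x)) \<in> borel_measurable N"
  using measurable_compose[OF measurable_Pair[OF assms] obs_jointly_measurable] by simp

lemma integrable_of_bounded:
  assumes "Z \<in> borel_measurable M" and "\<And>w. w \<in> space M \<Longrightarrow> \<bar>Z w\<bar> \<le> C"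
  shows "integrable M (Z :: 'w \<Rightarrow> real)"
  using assms by (intro integrable_const_bound[of _ C]) (auto intro: AE_I2)

lemma time_integral_Fubini:
  fixes H :: "real \<Rightarrow> 'w \<Rightarrow> real"
  assumes [measurable]: "(\<lambda>(s, w). H s w) \<in> borel_measurable (borel \<Otimes>\<^sub>M M)"
    and bound: "\<And>s w. s \<in> {a..b} \<Longrightarrow> w \<in> space M \<Longrightarrow> \<bar>H s w\<bar> \<le> C"
  shows "integrable M (\<lambda>w. LBINT s:{a..b}. H s w)"
    and "set_integrable lborel {a..b} (\<lambda>s. expectation (H s))"
    and "expectation (\<lambda>w. LBINT s:{a..b}. H s w) = (LBINT s:{a..b}. expectation (H s))"
    and "w \<in> space M \<Longrightarrow> set_integrable lborel {a..b} (\<lambda>s. H s w)"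
    and "w \<in> space M \<Longrightarrow> a \<le> b \<Longrightarrow> \<bar>LBINT s:{a..b}. H s w\<bar> \<le> (b - a) * C"
proof -
  interpret P: pair_sigma_finite lborel M ..
  let ?H = "\<lambda>s w. indicator {a..b} s *\<^sub>R H s w"
  have "emeasure (lborel \<Otimes>\<^sub>M M) ({a..b} \<times> space M) < \<infinity>"
    by (subst emeasure_pair_measure_Times)
       (auto simp: emeasure_space_1 emeasure_lborel_Icc_eq)
  then have I: "integrable (lborel \<Otimes>\<^sub>M M) (\<lambda>(s, w). ?H s w)"
    by (intro integrableI_bounded_set[of "{a..b} \<times> space M" _ _ C])
       (use bound in \<open>auto simp: space_pair_measure indicator_def intro!: AE_I2\<close>)
  show "integrable M (\<lambda>w. LBINT s:{a..b}. H s w)"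
    unfolding set_lebesgue_integral_def by (rule P.integrable_snd[OF I])
  show "set_integrable lborel {a..b} (\<lambda>s. expectation (H s))"
    unfolding set_integrable_def using P.integrable_fst[OF I] by simp
  show "expectation (\<lambda>w. LBINT s:{a..b}. H s w) = (LBINT s:{a..b}. expectation (H s))"
    unfolding set_lebesgue_integral_def using P.Fubini_integral[OF I] by simp
  assume w: "w \<in> space M"
  have [measurable]: "(\<lambda>s. H s w) \<in> borel_measurable borel"
    using w by measurable
  show path: "set_integrable lborel {a..b} (\<lambda>s. H s w)"
    unfolding set_integrable_def
    by (intro integrableI_bounded_set[of "{a..b}" _ _ C])
       (use bound w in \<open>auto simp: emeasure_lborel_Icc_eq indicator_def intro!: AE_I2\<close>)
  assume ab: "a \<le> b"
  have "\<bar>LBINT s:{a..b}. H s w\<bar> \<le> (LBINT s:{a..b}. \<bar>H s w\<bar>)"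
    using set_integral_norm_bound[OF path] by simp
  also have "\<dots> \<le> (LBINT s:{a..b}. C)"
  proof (rule set_integral_mono[OF set_integrable_abs[OF path]])
    show "set_integrable lborel {a..b} (\<lambda>s. C)"
      by (simp add: set_integrable_def emeasure_lborel_Icc_eq)
  qed (use bound w in auto)
  also have "\<dots> = (b - a) * C"
    using ab by (simp add: set_lebesgue_integral_def)
  finally show "\<bar>LBINT s:{a..b}. H s w\<bar> \<le> (b - a) * C" .
qed

text \<open>The Markov property in the only form used below: in a correlation, the later
  observable may be propagated back to the earlier time.\<close>

lemma obs_time_correlation:
  assumes s: "s \<ge> 0" and r: "r \<ge> 0"
  shows "expectation (\<lambda>w. obs u s w * obs v (s + r) w) = expectation (\<lambda>w. obs u s w * obs (S r v) s w)"
proof -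
  let ?G = "{X q -` A \<inter> space M | q A. 0 \<le> q \<and> q \<le> s \<and> A \<in> sets borel}"
  have G: "?G \<subseteq> Pow (space M)" by auto
  have sub: "subalgebra M (past M X s)"
    unfolding subalgebra_def past_def
  proof
    show "sets (sigma (space M) ?G) \<subseteq> sets M"
      unfolding sets_measure_of[OF G]
      by (rule sets.sigma_sets_subset) (auto intro: measurable_sets[OF X_measurable])
  qed (simp add: space_measure_of[OF G])
  interpret F: finite_measure_subalgebra M "past M X s"
    by unfold_locales (rule sub)
  have "X s \<in> borel_measurable (past M X s)"
  proof (rule measurableI)
    fix A :: "'a set" assume "A \<in> sets borel"
    then have "X s -` A \<inter> space M \<in> ?G"
      using s by blast
    then show "X s -` A \<inter> space (past M X s) \<in> sets (past M X s)"
      unfolding past_def space_measure_of[OF G] sets_measure_of[OF G]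
      by (rule sigma_sets.Basic)
  qed simp
  from measurable_compose[OF this borel_measurable_continuous_onI[OF continuous_on_apply_bcontfun]]
  have u: "obs u s \<in> borel_measurable (past M X s)"
    using s by (simp add: obs_def[abs_def])
  have prod_le: "\<bar>obs u s w * obs v (s + r) w\<bar> \<le> norm u * norm v" for w
    unfolding abs_mult by (intro mult_mono abs_obs_le) auto
  have "expectation (\<lambda>w. obs u s w * obs v (s + r) w)
      = expectation (\<lambda>w. obs u s w * real_cond_exp M (past M X s) (obs v (s + r)) w)"
    by (rule F.real_cond_exp_intg(2)[symmetric])
       (use u prod_le in \<open>auto intro!: integrable_of_bounded[of _ "norm u * norm v"]\<close>)
  also have "\<dots> = expectation (\<lambda>w. obs u s w * obs (S r v) s w)"
  proof (rule integral_cong_AE)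
    have obs_eq: "obs v (s + r) = (\<lambda>w. apply_bcontfun v (X (s + r) w))"
      using s r by (simp add: fun_eq_iff obs_nonneg_time)
    have "AE w in M. real_cond_exp M (past M X s) (obs v (s + r)) w = apply_bcontfun (S r v) (X s w)"
      using markov s r unfolding markov_with_semigroup_def obs_eq by blast
    then show "AE w in M. obs u s w * real_cond_exp M (past M X s) (obs v (s + r)) w
        = obs u s w * obs (S r v) s w"
      by eventually_elim (use s in \<open>simp add: obs_nonneg_time\<close>)
  qed auto
  finally show ?thesis .
qed

text \<open>As a function of the later time, a correlation is a fixed bounded linear functional of the
  semigroup, hence differentiable; this is the integrated form. It expresses that the increments of
  \<open>f(X t) - \<integral> g(X r) dr\<close> after time \<open>s\<close> are uncorrelated with every observable at time \<open>s\<close>.\<close>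

lemma dynkin_formula:
  assumes fg: "(f, g) \<in> semigroup_generator S" and s: "0 \<le> s" and st: "s \<le> t"
  shows "(LBINT r:{s..t}. expectation (\<lambda>w. obs u s w * obs g r w))
      = expectation (\<lambda>w. obs u s w * (obs f t w - obs f s w))"
proof -
  define L where "L = (\<lambda>v. expectation (\<lambda>w. obs u s w * obs v s w))"
  have le: "\<bar>obs u q w * obs v r w\<bar> \<le> norm u * norm v" for v q r w
    unfolding abs_mult by (intro mult_mono abs_obs_le) auto
  have int: "integrable M (\<lambda>w. obs u s w * obs v r w)" for v r
    by (rule integrable_of_bounded[of _ "norm u * norm v"]) (use le in auto)
  have L: "bounded_linear L"
  proof (rule bounded_linear_intro)
    show "L (v + v') = L v + L v'" for v v'
      using int by (simp add: L_def obs_def distrib_left)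
    show "L (c *\<^sub>R v) = c *\<^sub>R L v" for c v
      by (simp add: L_def obs_def mult.left_commute)
    have "\<bar>L v\<bar> \<le> norm u * norm v" for v
    proof -
      have "\<bar>L v\<bar> \<le> expectation (\<lambda>w. \<bar>obs u s w * obs v s w\<bar>)"
        unfolding L_def by (rule integral_abs_bound)
      also have "\<dots> \<le> norm u * norm v"
        by (rule integral_le_const) (use le int in \<open>auto intro: AE_I2\<close>)
      finally show ?thesis .
    qed
    then show "norm (L v) \<le> norm v * norm u" for v
      unfolding real_norm_def mult.commute[of "norm v"] .
  qed
  have corr: "expectation (\<lambda>w. obs u s w * obs v r w) = L (S (r - s) v)" if "r \<in> {s..t}" for v r
    unfolding L_def using obs_time_correlation[of s "r - s" u v] s that by simp
  have "((\<lambda>r. L (S (r - s) g)) has_integral (L (S (t - s) f) - L (S (s - s) f))) {s..t}"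
  proof (rule fundamental_theorem_of_calculus[OF st])
    fix r assume r: "r \<in> {s..t}"
    have 1: "((\<lambda>r. r - s) has_vector_derivative 1) (at r within {s..t})"
      by (auto intro!: derivative_eq_intros)
    have "((\<lambda>r. S r f) has_vector_derivative S (r - s) g) (at (r - s) within (\<lambda>r. r - s) ` {s..t})"
      by (rule has_vector_derivative_within_subset[OF semigroup_has_vector_derivative[OF semigroup fg]])
         (use r in auto)
    from vector_diff_chain_within[OF 1 this]
    have "((\<lambda>r. S (r - s) f) has_vector_derivative S (r - s) g) (at r within {s..t})"
      by (simp add: o_def)
    from bounded_linear.has_vector_derivative[OF L this]
    show "((\<lambda>r. L (S (r - s) f)) has_vector_derivative L (S (r - s) g)) (at r within {s..t})" .
  qed
  moreover have "L (S (t - s) f) - L (S (s - s) f)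
      = expectation (\<lambda>w. obs u s w * (obs f t w - obs f s w))"
    using corr[of t f] corr[of s f] st int by (simp add: right_diff_distrib)
  ultimately have "((\<lambda>r. L (S (r - s) g)) has_integral
      expectation (\<lambda>w. obs u s w * (obs f t w - obs f s w))) {s..t}"
    by simp
  then have "((\<lambda>r. expectation (\<lambda>w. obs u s w * obs g r w)) has_integral
      expectation (\<lambda>w. obs u s w * (obs f t w - obs f s w))) {s..t}"
    by (simp only: corr cong: has_integral_cong)
  moreover have "set_integrable lborel {s..t} (\<lambda>r. expectation (\<lambda>w. obs u s w * obs g r w))"
    by (rule time_integral_Fubini(2)[where C = "norm u * norm g"]) (use le in auto)
  ultimately show ?thesis
    by (simp add: set_borel_integral_eq_integral integral_unique)
qed

definition dynkin_martingale ::
    "('a \<Rightarrow>\<^sub>C real) \<Rightarrow> ('a \<Rightarrow>\<^sub>C real) \<Rightarrow> real \<Rightarrow> 'w \<Rightarrow> real" where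
  "dynkin_martingale f g t w = obs f t w - obs f 0 w - (LBINT s:{0..t}. obs g s w)"

text \<open>The integrand \<open>q - 2 f g\<close> is the carre du champ of \<open>f\<close>. The square is
  expanded into time integrals of two-time correlations. After the Dynkin formula has been applied to
  each of them, the correlations of \<open>g\<close> with \<open>f\<close> at the two ends of the time interval cancel, and only
  equal-time terms remain.\<close>

lemma dynkin_martingale_variance:
  assumes fg: "(f, g) \<in> semigroup_generator S" and f2q: "(f2, q) \<in> semigroup_generator S"
    and f2: "\<And>x. apply_bcontfun f2 x = (apply_bcontfun f x)\<^sup>2" and t: "t \<ge> 0"
  shows "integrable M (\<lambda>w. (dynkin_martingale f g t w)\<^sup>2)"
    and "expectation (\<lambda>w. (dynkin_martingale f g t w)\<^sup>2)
      = (LBINT s:{0..t}. expectation (\<lambda>w. obs q s w - 2 * (obs f s w * obs g s w)))"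
proof -
  define A where "A = (\<lambda>w. LBINT s:{0..t}. obs g s w)"
  define a where "a = (\<lambda>w. obs f t w - obs f 0 w)"
  have A_meas [measurable]: "A \<in> borel_measurable M"
    unfolding A_def set_lebesgue_integral_def by measurable
  have a_meas [measurable]: "a \<in> borel_measurable M"
    unfolding a_def by measurable
  have A_le: "\<bar>A w\<bar> \<le> t * norm g" if "w \<in> space M" for w
    unfolding A_def using time_integral_Fubini(5)[of "obs g" 0 t "norm g" w] abs_obs_le that t
    by simp
  have a_le: "\<bar>a w\<bar> \<le> 2 * norm f" for w
    unfolding a_def using abs_obs_le[of f t w] abs_obs_le[of f 0 w] by linarith
  have oo_le: "\<bar>obs u r w * obs v s w\<bar> \<le> norm u * norm v" for u v r s w
    unfolding abs_mult by (intro mult_mono abs_obs_le) auto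
  have oo: "integrable M (\<lambda>w. obs u r w * obs v s w)" for u v r s
    by (rule integrable_of_bounded[of _ "norm u * norm v"]) (use oo_le in auto)
  have o: "integrable M (obs u r)" for u r
    by (rule integrable_of_bounded[of _ "norm u"]) (use abs_obs_le in auto)
  have ooI: "set_integrable lborel {0..t} (\<lambda>s. expectation (\<lambda>w. obs u (r s) w * obs v (p s) w))"
    if [measurable]: "r \<in> borel_measurable borel" "p \<in> borel_measurable borel" for u v r p
    by (rule time_integral_Fubini(2)[where C = "norm u * norm v"]) (use oo_le in auto)
  have oI: "set_integrable lborel {0..t} (\<lambda>s. expectation (obs u s))" for u
    by (rule time_integral_Fubini(2)[where C = "norm u"]) (use abs_obs_le in auto)
  have dyn: "(LBINT s:{r..t}. expectation (\<lambda>w. obs u r w * obs g s w))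
      = expectation (\<lambda>w. obs u r w * obs f t w) - expectation (\<lambda>w. obs u r w * obs f r w)"
    if "0 \<le> r" "r \<le> t" for u r
    using dynkin_formula[OF fg that] oo by (simp add: right_diff_distrib)
  have sq: "obs f r w * obs f r w = obs f2 r w" for r w
    by (simp add: obs_def f2 power2_eq_square)

  have aa: "integrable M (\<lambda>w. (a w)\<^sup>2)"
    by (rule integrable_of_bounded[of _ "(2 * norm f)\<^sup>2"])
       (use power_mono[OF a_le abs_ge_zero, where n = 2] in simp_all)
  have AA: "integrable M (\<lambda>w. (A w)\<^sup>2)"
    by (rule integrable_of_bounded[of _ "(t * norm g)\<^sup>2"])
       (use power_mono[OF A_le abs_ge_zero, where n = 2] in simp_all)
  have aA: "integrable M (\<lambda>w. a w * A w)"
    by (rule integrable_of_bounded[of _ "(2 * norm f) * (t * norm g)"])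
       (use a_le A_le t in \<open>auto simp: abs_mult intro!: mult_mono\<close>)

  have M_sq: "(dynkin_martingale f g t w)\<^sup>2 = (a w)\<^sup>2 - 2 * (a w * A w) + (A w)\<^sup>2" for w
    by (simp add: dynkin_martingale_def A_def a_def power2_eq_square algebra_simps)
  show "integrable M (\<lambda>w. (dynkin_martingale f g t w)\<^sup>2)"
    unfolding M_sq using aa AA aA by simp

  \<comment> \<open>Squares at a single time are observables of \<open>f2\<close>, so their growth is governed by \<open>q\<close>.\<close>
  have E_aa: "expectation (\<lambda>w. (a w)\<^sup>2)
      = (LBINT s:{0..t}. expectation (obs q s)) - 2 * (LBINT s:{0..t}. expectation (\<lambda>w. obs f 0 w * obs g s w))"
  proof -
    have one: "obs (const_bcontfun 1) r w = 1" for r w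
      by (simp add: obs_def)
    have "(LBINT s:{0..t}. expectation (obs q s)) = expectation (obs f2 t) - expectation (obs f2 0)"
      using dynkin_formula[OF f2q order_refl t, of "const_bcontfun 1"] o by (simp add: one)
    moreover have "(a w)\<^sup>2 = obs f2 t w - 2 * (obs f 0 w * obs f t w) + obs f2 0 w" for w
      by (simp add: a_def power2_eq_square algebra_simps flip: sq)
    ultimately show ?thesis
      using o oo dyn[OF order_refl t, of f] by (simp add: sq)
  qed
  have E_aA: "expectation (\<lambda>w. a w * A w)
      = (LBINT s:{0..t}. expectation (\<lambda>w. obs g s w * obs f t w) - expectation (\<lambda>w. obs f 0 w * obs g s w))"
  proof -
    have "expectation (\<lambda>w. a w * A w) = expectation (\<lambda>w. LBINT s:{0..t}. a w * obs g s w)"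
      by (simp add: A_def)
    also have "\<dots> = (LBINT s:{0..t}. expectation (\<lambda>w. a w * obs g s w))"
      by (rule time_integral_Fubini(3)[where C = "(2 * norm f) * norm g"])
         (use a_le abs_obs_le in \<open>auto simp: abs_mult intro!: mult_mono\<close>)
    also have "(\<lambda>s. expectation (\<lambda>w. a w * obs g s w))
        = (\<lambda>s. expectation (\<lambda>w. obs g s w * obs f t w) - expectation (\<lambda>w. obs f 0 w * obs g s w))"
      unfolding a_def left_diff_distrib using oo
      by (subst Bochner_Integration.integral_diff) (auto simp: mult.commute)
    finally show ?thesis .
  qed
  \<comment> \<open>The inner integral from \<open>s\<close> to \<open>t\<close> may be replaced by the increment of \<open>f\<close>: the
    difference is a martingale increment, uncorrelated with \<open>g\<close> at time \<open>s\<close>.\<close>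
  have E_AA: "expectation (\<lambda>w. (A w)\<^sup>2)
      = 2 * (LBINT s:{0..t}. expectation (\<lambda>w. obs g s w * obs f t w) - expectation (\<lambda>w. obs f s w * obs g s w))"
  proof -
    have "expectation (\<lambda>w. (A w)\<^sup>2)
        = expectation (\<lambda>w. 2 * (LBINT s:{0..t}. obs g s w * (LBINT r:{s..t}. obs g r w)))"
      unfolding A_def
      by (intro Bochner_Integration.integral_cong[OF refl] square_time_integral[of _ "norm g"] abs_obs_le) measurable
    also have "\<dots> = 2 * expectation (\<lambda>w. LBINT s:{0..t}. obs g s w * (LBINT r:{s..t}. obs g r w))"
      by simp
    also have "expectation (\<lambda>w. LBINT s:{0..t}. obs g s w * (LBINT r:{s..t}. obs g r w))
        = (LBINT s:{0..t}. expectation (\<lambda>w. obs g s w * (LBINT r:{s..t}. obs g r w)))"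
    proof (rule time_integral_Fubini(3)[where C = "norm g * (t * norm g)"])
      show "(\<lambda>(s, w). obs g s w * (LBINT r:{s..t}. obs g r w)) \<in> borel_measurable (borel \<Otimes>\<^sub>M M)"
      proof -
        have "(\<lambda>(x, r). if fst x \<le> r \<and> r \<le> t then obs g r (snd x) else 0)
            \<in> borel_measurable ((borel \<Otimes>\<^sub>M M) \<Otimes>\<^sub>M borel)"
          by measurable
        then have "(\<lambda>(x, r). if fst x \<le> r \<and> r \<le> t then obs g r (snd x) else 0)
            \<in> borel_measurable ((borel \<Otimes>\<^sub>M M) \<Otimes>\<^sub>M lborel)"
          by (simp cong: measurable_cong_sets sets_pair_measure_cong)
        from lborel.borel_measurable_lebesgue_integral[OF this]
        have "(\<lambda>x. LBINT r:{fst x..t}. obs g r (snd x)) \<in> borel_measurable (borel \<Otimes>\<^sub>M M)"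
          by (simp add: set_lebesgue_integral_def indicator_def if_distrib[where f = "\<lambda>c. c * _"]
              cong: if_cong)
        moreover have "(\<lambda>x. obs g (fst x) (snd x)) \<in> borel_measurable (borel \<Otimes>\<^sub>M M)"
          by measurable
        ultimately show ?thesis
          by (simp add: case_prod_beta)
      qed
      fix s w assume s: "s \<in> {0..t}" and w: "w \<in> space M"
      have "\<bar>LBINT r:{s..t}. obs g r w\<bar> \<le> (t - s) * norm g"
        using time_integral_Fubini(5)[of "obs g" s t "norm g" w] abs_obs_le w s by simp
      also have "\<dots> \<le> t * norm g"
        using s by (intro mult_right_mono) auto
      finally show "\<bar>obs g s w * (LBINT r:{s..t}. obs g r w)\<bar> \<le> norm g * (t * norm g)"
        unfolding abs_mult using abs_obs_le by (intro mult_mono) auto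
    qed
    also have "\<dots> = (LBINT s:{0..t}. expectation (\<lambda>w. obs g s w * obs f t w) - expectation (\<lambda>w. obs f s w * obs g s w))"
    proof (rule set_lebesgue_integral_cong; clarsimp)
      fix s assume s: "0 \<le> s" "s \<le> t"
      have "expectation (\<lambda>w. obs g s w * (LBINT r:{s..t}. obs g r w))
          = expectation (\<lambda>w. LBINT r:{s..t}. obs g s w * obs g r w)"
        by simp
      also have "\<dots> = (LBINT r:{s..t}. expectation (\<lambda>w. obs g s w * obs g r w))"
        by (rule time_integral_Fubini(3)[where C = "norm g * norm g"]) (use oo_le in auto)
      finally show "expectation (\<lambda>w. obs g s w * (LBINT r:{s..t}. obs g r w))
          = expectation (\<lambda>w. obs g s w * obs f t w) - expectation (\<lambda>w. obs f s w * obs g s w)"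
        using dyn[OF s, of g] by (simp add: mult.commute)
    qed
    finally show ?thesis .
  qed

  have I1: "set_integrable lborel {0..t} (\<lambda>s. expectation (\<lambda>w. obs f 0 w * obs g s w))"
    and I2: "set_integrable lborel {0..t} (\<lambda>s. expectation (\<lambda>w. obs g s w * obs f t w))"
    and I3: "set_integrable lborel {0..t} (\<lambda>s. expectation (\<lambda>w. obs f s w * obs g s w))"
    by (rule ooI; measurable)+
  have "expectation (\<lambda>w. (dynkin_martingale f g t w)\<^sup>2)
      = expectation (\<lambda>w. (a w)\<^sup>2) - 2 * expectation (\<lambda>w. a w * A w) + expectation (\<lambda>w. (A w)\<^sup>2)"
    unfolding M_sq using aa aA AA by simp
  also have "\<dots> = (LBINT s:{0..t}. expectation (obs q s)) - 2 * (LBINT s:{0..t}. expectation (\<lambda>w. obs f s w * obs g s w))"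
    unfolding E_aa E_aA E_AA using I1 I2 I3 by (simp add: set_integral_diff)
  also have "\<dots> = (LBINT s:{0..t}. expectation (obs q s) - 2 * expectation (\<lambda>w. obs f s w * obs g s w))"
    using I3 oI by (simp add: set_integral_diff)
  also have "\<dots> = (LBINT s:{0..t}. expectation (\<lambda>w. obs q s w - 2 * (obs f s w * obs g s w)))"
    using o oo by simp
  finally show "expectation (\<lambda>w. (dynkin_martingale f g t w)\<^sup>2)
      = (LBINT s:{0..t}. expectation (\<lambda>w. obs q s w - 2 * (obs f s w * obs g s w)))" .
qed

text \<open>If \<open>g\<close> approximates \<open>V\<close>, then \<open>\<integral> V(X s) ds\<close> is close to \<open>\<integral> g(X s) ds\<close>, which is the
  increment of \<open>f\<close> minus a martingale. The three terms of the bound are the increment, the error in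
  the approximation, and the martingale, estimated in mean square.\<close>

lemma expectation_abs_time_integral_le:
  assumes fg: "(f, g) \<in> semigroup_generator S" and f2q: "(f2, q) \<in> semigroup_generator S"
    and f2: "\<And>x. apply_bcontfun f2 x = (apply_bcontfun f x)\<^sup>2" and t: "t \<ge> 0"
    and f_le: "\<And>x. \<bar>apply_bcontfun f x\<bar> \<le> a"
    and V_g: "\<And>x. \<bar>apply_bcontfun V x - apply_bcontfun g x\<bar> \<le> b"
    and cdc: "\<And>x. apply_bcontfun q x - 2 * (apply_bcontfun f x * apply_bcontfun g x) \<le> c"
  shows "expectation (\<lambda>w. \<bar>LBINT s:{0..t}. obs V s w\<bar>) \<le> 2 * a + t * b + sqrt (t * c)"
proof -
  let ?D = "dynkin_martingale f g t"
  note var = dynkin_martingale_variance[OF fg f2q f2 t]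
  have D_meas [measurable]: "?D \<in> borel_measurable M"
    unfolding dynkin_martingale_def set_lebesgue_integral_def by measurable
  have "integrable M (obs f r)" for r
    by (rule integrable_of_bounded[of _ "norm f"]) (use abs_obs_le in auto)
  then have D_int: "integrable M ?D"
    unfolding dynkin_martingale_def
    using time_integral_Fubini(1)[of "obs g" 0 t "norm g"] abs_obs_le by simp
  have "expectation (\<lambda>w. (?D w)\<^sup>2) \<le> (LBINT s:{0..t}. c)"
    unfolding var(2)
  proof (rule set_integral_mono)
    have le: "\<bar>obs q s w - 2 * (obs f s w * obs g s w)\<bar> \<le> norm q + 2 * (norm f * norm g)" for s w
    proof -
      have "\<bar>obs f s w * obs g s w\<bar> \<le> norm f * norm g"
        unfolding abs_mult by (intro mult_mono abs_obs_le) auto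
      then show ?thesis
        using abs_obs_le[of q s w] by linarith
    qed
    show "set_integrable lborel {0..t} (\<lambda>s. expectation (\<lambda>w. obs q s w - 2 * (obs f s w * obs g s w)))"
      by (rule time_integral_Fubini(2)) (use le in auto)
    show "set_integrable lborel {0..t} (\<lambda>s. c)"
      by (simp add: set_integrable_def emeasure_lborel_Icc_eq)
    show "expectation (\<lambda>w. obs q s w - 2 * (obs f s w * obs g s w)) \<le> c" for s
    proof (rule integral_le_const)
      show "integrable M (\<lambda>w. obs q s w - 2 * (obs f s w * obs g s w))"
        by (rule integrable_of_bounded[OF _ le]) measurable
      show "AE w in M. obs q s w - 2 * (obs f s w * obs g s w) \<le> c"
        using cdc by (simp add: obs_def)
    qed
  qed
  also have "(LBINT s:{0..t}. c) = t * c"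
    using t by (simp add: set_lebesgue_integral_def)
  finally have ED2: "expectation (\<lambda>w. (?D w)\<^sup>2) \<le> t * c" .
  \<comment> \<open>Jensen's inequality, in the form that the variance of \<open>\<bar>?D\<bar>\<close> is nonnegative.\<close>
  have "(expectation (\<lambda>w. \<bar>?D w\<bar>))\<^sup>2 \<le> expectation (\<lambda>w. \<bar>?D w\<bar>\<^sup>2)"
    using variance_positive[of "\<lambda>w. \<bar>?D w\<bar>"] variance_eq[of "\<lambda>w. \<bar>?D w\<bar>"] D_int var(1) by simp
  then have ED: "expectation (\<lambda>w. \<bar>?D w\<bar>) \<le> sqrt (t * c)"
    using ED2 by (simp add: real_le_rsqrt)

  have "\<bar>LBINT s:{0..t}. obs V s w\<bar> \<le> 2 * a + t * b + \<bar>?D w\<bar>" if w: "w \<in> space M" for w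
  proof -
    have IV: "set_integrable lborel {0..t} (\<lambda>s. obs h s w)" for h
      by (rule time_integral_Fubini(4)[where C = "norm h"]) (use abs_obs_le w in auto)
    have "\<bar>obs V s w - obs g s w\<bar> \<le> b" for s w
      by (simp add: obs_def V_g)
    then have "\<bar>LBINT s:{0..t}. obs V s w - obs g s w\<bar> \<le> t * b"
      using time_integral_Fubini(5)[of "\<lambda>s w. obs V s w - obs g s w" 0 t b] w t by simp
    moreover have "(LBINT s:{0..t}. obs V s w - obs g s w)
        = (LBINT s:{0..t}. obs V s w) - (LBINT s:{0..t}. obs g s w)"
      by (rule set_integral_diff(2)[OF IV IV])
    moreover have "(LBINT s:{0..t}. obs g s w) = obs f t w - obs f 0 w - ?D w"
      by (simp add: dynkin_martingale_def)
    moreover have "\<bar>obs f r w\<bar> \<le> a" for r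
      by (simp add: obs_def f_le)
    from this[of t] this[of 0] have "\<bar>obs f t w - obs f 0 w\<bar> \<le> 2 * a" by linarith
    ultimately show ?thesis by linarith
  qed
  then have "expectation (\<lambda>w. \<bar>LBINT s:{0..t}. obs V s w\<bar>)
      \<le> expectation (\<lambda>w. 2 * a + t * b + \<bar>?D w\<bar>)"
    using time_integral_Fubini(1)[of "obs V" 0 t "norm V"] abs_obs_le D_int
    by (intro integral_mono) auto
  also have "\<dots> = 2 * a + t * b + expectation (\<lambda>w. \<bar>?D w\<bar>)"
    using D_int by (simp add: prob_space)
  finally show ?thesis
    using ED by linarith
qed

end


section \<open>Linear functions of the configuration\<close>

definition occupation_sum :: "(int \<Rightarrow> real) \<Rightarrow> int set \<Rightarrow> config \<Rightarrow> real" where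
  "occupation_sum \<phi> A \<xi> = (\<Sum>x\<in>A. \<phi> x * of_bool (\<xi> x))"

lemma local_function_occupation_sum: "finite A \<Longrightarrow> local_function (occupation_sum \<phi> A)"
  unfolding local_function_def occupation_sum_def by (intro exI[of _ A]) simp

lemma local_function_power2:
  assumes "local_function f"
  shows "local_function (\<lambda>\<xi>. (f \<xi>)\<^sup>2)"
proof -
  obtain A where "finite A" "\<forall>\<xi> \<eta>. (\<forall>x\<in>A. \<xi> x = \<eta> x) \<longrightarrow> f \<xi> = f \<eta>"
    using assms unfolding local_function_def by blast
  then show ?thesis
    unfolding local_function_def by (intro exI[of _ A]) (metis (full_types))
qed

lemma occupation_sum_exchange:
  assumes A: "finite A" "\<And>x. x \<notin> A \<Longrightarrow> \<phi> x = 0"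
  shows "occupation_sum \<phi> A (exchange z \<xi>) - occupation_sum \<phi> A \<xi>
    = (\<phi> (z + 1) - \<phi> z) * (of_bool (\<xi> z) - of_bool (\<xi> (z + 1)))"
proof -
  have "occupation_sum \<phi> A (exchange z \<xi>) - occupation_sum \<phi> A \<xi>
      = (\<Sum>x\<in>A. \<phi> x * (of_bool (exchange z \<xi> x) - of_bool (\<xi> x)))"
    by (simp add: occupation_sum_def right_diff_distrib sum_subtractf)
  also have "\<dots> = (\<Sum>x\<in>{z, z + 1}. \<phi> x * (of_bool (exchange z \<xi> x) - of_bool (\<xi> x)))"
    by (rule sum.mono_neutral_cong) (use A in \<open>auto simp: exchange_def\<close>)
  also have "\<dots> = (\<phi> (z + 1) - \<phi> z) * (of_bool (\<xi> z) - of_bool (\<xi> (z + 1)))"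
    by (simp add: exchange_def algebra_simps)
  finally show ?thesis .
qed

text \<open>Shifting the configuration amounts to shifting the coefficients, so the change is at most
  their total variation.\<close>

lemma abs_occupation_sum_shift_le:
  assumes A: "finite A" "\<And>x. x \<notin> A \<Longrightarrow> \<phi> x = 0"
    and E: "finite E" "\<And>x. x \<notin> E \<Longrightarrow> \<phi> (x + 1) = \<phi> x"
    and y: "y \<in> {1, -1}"
  shows "\<bar>occupation_sum \<phi> A (shift_config y \<xi>) - occupation_sum \<phi> A \<xi>\<bar>
    \<le> (\<Sum>x\<in>E. \<bar>\<phi> (x + 1) - \<phi> x\<bar>)"
proof -
  define C where "C = (if y = 1 then (\<lambda>x. x + 1) ` E else E)"
  define U where "U = C \<union> A \<union> (\<lambda>x. x + y) ` A"
  have C: "finite C" "\<And>x. x \<notin> C \<Longrightarrow> \<phi> (x - y) = \<phi> x"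
  proof -
    show "finite C" using E by (simp add: C_def)
    fix x assume x: "x \<notin> C"
    show "\<phi> (x - y) = \<phi> x"
    proof (cases "y = 1")
      case True
      then have "x - 1 \<notin> E"
        using x by (auto simp: C_def image_iff dest: bspec[where x = "x - 1"])
      with E(2)[of "x - 1"] True show ?thesis by simp
    next
      case False
      then show ?thesis using x y E(2)[of x] by (simp add: C_def)
    qed
  qed
  have U: "finite U" using A C by (simp add: U_def)
  have "occupation_sum \<phi> A (shift_config y \<xi>)
      = (\<Sum>x\<in>(\<lambda>x. x + y) ` A. \<phi> (x - y) * of_bool (\<xi> x))"
    by (simp add: occupation_sum_def shift_config_def sum.reindex inj_on_def)
  also have "\<dots> = (\<Sum>x\<in>U. \<phi> (x - y) * of_bool (\<xi> x))"
  proof (rule sum.mono_neutral_left)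
    show "\<forall>x\<in>U - (\<lambda>x. x + y) ` A. \<phi> (x - y) * of_bool (\<xi> x) = 0"
    proof
      fix x assume "x \<in> U - (\<lambda>x. x + y) ` A"
      then have "x - y \<notin> A" by (auto simp: image_iff dest: bspec[where x = "x - y"])
      then show "\<phi> (x - y) * of_bool (\<xi> x) = 0" by (simp add: A)
    qed
  qed (use U in \<open>auto simp: U_def\<close>)
  finally have shifted: "occupation_sum \<phi> A (shift_config y \<xi>)
      = (\<Sum>x\<in>U. \<phi> (x - y) * of_bool (\<xi> x))" .
  have "occupation_sum \<phi> A \<xi> = (\<Sum>x\<in>U. \<phi> x * of_bool (\<xi> x))"
    unfolding occupation_sum_def
    by (rule sum.mono_neutral_left) (use U A in \<open>auto simp: U_def\<close>)
  then have "\<bar>occupation_sum \<phi> A (shift_config y \<xi>) - occupation_sum \<phi> A \<xi>\<bar>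
      = \<bar>\<Sum>x\<in>U. (\<phi> (x - y) - \<phi> x) * of_bool (\<xi> x)\<bar>"
    by (simp add: shifted left_diff_distrib sum_subtractf)
  also have "\<dots> \<le> (\<Sum>x\<in>U. \<bar>\<phi> (x - y) - \<phi> x\<bar>)"
    by (rule order_trans[OF sum_abs]) (auto intro!: sum_mono simp: abs_mult)
  also have "\<dots> = (\<Sum>x\<in>C. \<bar>\<phi> (x - y) - \<phi> x\<bar>)"
    by (rule sum.mono_neutral_right) (use U C in \<open>auto simp: U_def\<close>)
  also have "\<dots> = (\<Sum>x\<in>E. \<bar>\<phi> (x + 1) - \<phi> x\<bar>)"
    using y by (auto simp: C_def sum.reindex inj_on_def abs_minus_commute)
  finally show ?thesis .
qed

lemma infsum_finite_support:
  fixes h :: "'b \<Rightarrow> real"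
  assumes "finite E" and "\<And>z. z \<notin> E \<Longrightarrow> h z = 0"
  shows "(\<Sum>\<^sub>\<infinity>z\<in>UNIV. h z) = (\<Sum>z\<in>E. h z)"
  using infsum_cong_neutral[of E UNIV h h] assms by (simp add: infsum_finite)

text \<open>Summation by parts: the symmetric exclusion dynamics acts on linear functions of the
  configuration through the discrete Laplacian of the coefficients. This is why the Poisson equation
  for a linear observable can be solved explicitly.\<close>

lemma exclusion_generator_occupation_sum:
  assumes A: "finite A" "\<And>x. x \<notin> A \<Longrightarrow> \<phi> x = 0"
    and G: "finite G" "\<And>x. x \<notin> G \<Longrightarrow> (\<phi> (x + 1) - \<phi> x) - (\<phi> x - \<phi> (x - 1)) = 0"
  shows "(\<Sum>\<^sub>\<infinity>z\<in>UNIV. occupation_sum \<phi> A (exchange z \<xi>) - occupation_sum \<phi> A \<xi>)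
    = (\<Sum>x\<in>G. ((\<phi> (x + 1) - \<phi> x) - (\<phi> x - \<phi> (x - 1))) * of_bool (\<xi> x))"
proof -
  define D where "D = (\<lambda>x. \<phi> (x + 1) - \<phi> x)"
  define E where "E = A \<union> (\<lambda>x. x - 1) ` A"
  define U where "U = G \<union> E \<union> (\<lambda>x. x + 1) ` E"
  have E: "D x = 0" if "x \<notin> E" for x
  proof -
    have "x \<notin> A" "x + 1 \<notin> A"
      using that by (auto simp: E_def image_iff dest: bspec[where x = "x + 1"])
    then show ?thesis by (simp add: D_def A)
  qed
  have finE: "finite E" using A by (simp add: E_def)
  have U: "finite U" using G finE by (simp add: U_def)
  have "(\<Sum>\<^sub>\<infinity>z\<in>UNIV. occupation_sum \<phi> A (exchange z \<xi>) - occupation_sum \<phi> A \<xi>)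
      = (\<Sum>\<^sub>\<infinity>z\<in>UNIV. D z * (of_bool (\<xi> z) - of_bool (\<xi> (z + 1))))"
    by (simp add: occupation_sum_exchange[OF A] D_def)
  also have "\<dots> = (\<Sum>z\<in>E. D z * (of_bool (\<xi> z) - of_bool (\<xi> (z + 1))))"
    by (rule infsum_finite_support) (use finE E in auto)
  also have "\<dots> = (\<Sum>z\<in>E. D z * of_bool (\<xi> z)) - (\<Sum>z\<in>E. D z * of_bool (\<xi> (z + 1)))"
    by (simp add: right_diff_distrib sum_subtractf)
  also have "(\<Sum>z\<in>E. D z * of_bool (\<xi> z)) = (\<Sum>z\<in>U. D z * of_bool (\<xi> z))"
    by (rule sum.mono_neutral_left) (use U E in \<open>auto simp: U_def\<close>)
  also have "(\<Sum>z\<in>E. D z * of_bool (\<xi> (z + 1))) = (\<Sum>x\<in>(\<lambda>x. x + 1) ` E. D (x - 1) * of_bool (\<xi> x))"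
    by (simp add: sum.reindex inj_on_def)
  also have "\<dots> = (\<Sum>x\<in>U. D (x - 1) * of_bool (\<xi> x))"
  proof (rule sum.mono_neutral_left)
    show "\<forall>x\<in>U - (\<lambda>x. x + 1) ` E. D (x - 1) * of_bool (\<xi> x) = 0"
    proof
      fix x assume "x \<in> U - (\<lambda>x. x + 1) ` E"
      then have "x - 1 \<notin> E" by (auto simp: image_iff dest: bspec[where x = "x - 1"])
      then show "D (x - 1) * of_bool (\<xi> x) = 0" by (simp add: E)
    qed
  qed (use U in \<open>auto simp: U_def\<close>)
  also have "(\<Sum>z\<in>U. D z * of_bool (\<xi> z)) - (\<Sum>x\<in>U. D (x - 1) * of_bool (\<xi> x))
      = (\<Sum>x\<in>U. (D x - D (x - 1)) * of_bool (\<xi> x))"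
    by (simp add: left_diff_distrib sum_subtractf)
  also have "\<dots> = (\<Sum>x\<in>G. (D x - D (x - 1)) * of_bool (\<xi> x))"
    by (rule sum.mono_neutral_right) (use U G in \<open>auto simp: U_def D_def\<close>)
  finally show ?thesis
    by (simp add: D_def)
qed

text \<open>Each jump from \<open>f \<xi>\<close> to \<open>a\<close> contributes
  \<open>a\<^sup>2 - (f \<xi>)\<^sup>2 - 2 f \<xi> (a - f \<xi>) = (a - f \<xi>)\<^sup>2\<close>.\<close>

lemma carre_du_champ:
  assumes E: "finite E" "\<And>z. z \<notin> E \<Longrightarrow> f (exchange z \<xi>) = f \<xi>"
  shows "env_generator \<alpha> \<beta> n (\<lambda>\<eta>. (f \<eta>)\<^sup>2) \<xi> - 2 * (f \<xi> * env_generator \<alpha> \<beta> n f \<xi>)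
    = (real n)\<^sup>2 * (\<Sum>z\<in>E. (f (exchange z \<xi>) - f \<xi>)\<^sup>2)
      + real n * (\<Sum>y\<in>{1, -1}. jump_rate \<alpha> \<beta> y (of_bool (\<xi> 0)) * (f (shift_config y \<xi>) - f \<xi>)\<^sup>2)"
proof -
  have sq: "a\<^sup>2 - b\<^sup>2 = (a - b)\<^sup>2 + 2 * b * (a - b)" for a b :: real
    by (simp add: power2_eq_square algebra_simps)
  have 1: "(\<Sum>\<^sub>\<infinity>z\<in>UNIV. f (exchange z \<xi>) - f \<xi>) = (\<Sum>z\<in>E. f (exchange z \<xi>) - f \<xi>)"
    by (rule infsum_finite_support) (use E in auto)
  have "(\<Sum>\<^sub>\<infinity>z\<in>UNIV. (f (exchange z \<xi>))\<^sup>2 - (f \<xi>)\<^sup>2) = (\<Sum>z\<in>E. (f (exchange z \<xi>))\<^sup>2 - (f \<xi>)\<^sup>2)"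
    by (rule infsum_finite_support) (use E in auto)
  also have "\<dots> = (\<Sum>z\<in>E. (f (exchange z \<xi>) - f \<xi>)\<^sup>2) + 2 * f \<xi> * (\<Sum>z\<in>E. f (exchange z \<xi>) - f \<xi>)"
    unfolding sq[of _ "f \<xi>"] by (simp add: sum.distrib sum_distrib_left)
  finally show ?thesis
    unfolding env_generator_def 1 by (simp add: sq[of _ "f \<xi>"] algebra_simps)
qed

lemma jump_rate_nonneg: "\<alpha> \<ge> 0 \<Longrightarrow> \<beta> \<ge> 0 \<Longrightarrow> jump_rate \<alpha> \<beta> y (of_bool b) \<ge> 0"
  by (cases b) (auto simp: jump_rate_def)

text \<open>The two jump rates always add up to \<open>\<alpha> + \<beta>\<close>, on an occupied as on an empty site.\<close>

lemma sum_jump_rate_le: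
  assumes "\<alpha> \<ge> 0" "\<beta> \<ge> 0" and h: "\<And>y. y \<in> {1, -1} \<Longrightarrow> h y \<le> B"
  shows "(\<Sum>y\<in>{1, -1}. jump_rate \<alpha> \<beta> y (of_bool b) * h y) \<le> (\<alpha> + \<beta>) * B"
proof -
  have "(\<Sum>y\<in>{1, -1}. jump_rate \<alpha> \<beta> y (of_bool b) * h y)
      \<le> (\<Sum>y\<in>{1, -1::int}. jump_rate \<alpha> \<beta> y (of_bool b) * B)"
    by (intro sum_mono mult_left_mono h jump_rate_nonneg assms) auto
  also have "\<dots> = (\<alpha> + \<beta>) * B"
    by (cases b) (auto simp: jump_rate_def algebra_simps)
  finally show ?thesis .
qed


section \<open>Solving the Poisson equation on a finite window\<close>

text \<open>Integrating \<open>\<delta>\<^sub>0 - (1/k) 1\<^bsub>{1..k}\<^esub>\<close> twice from the right gives a parabola on \<open>{0..k}\<close> which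
  takes the value \<open>- (k + 1) / 2\<close> at 0 and would stay constant on the negative half-line. To obtain a
  finitely supported function it is instead brought back to 0 linearly over the \<open>m\<close> sites to the left
  of 0; the two kinks of this ramp, at 0 and at \<open>- m\<close>, are the only defect in the equation.\<close>

definition poisson_solution :: "int \<Rightarrow> int \<Rightarrow> int \<Rightarrow> real" where
  "poisson_solution k m x =
    (if x \<le> - m then 0
     else if x \<le> 0 then - (real_of_int k + 1) / 2 * (1 + real_of_int x / real_of_int m)
     else if x \<le> k then - (real_of_int k - real_of_int x) * (real_of_int k - real_of_int x + 1) / (2 * real_of_int k)
     else 0)"

context
  fixes k m :: int
  assumes k: "k \<ge> 1" and m: "m \<ge> 1"
begin

lemma poisson_solution_outside: "x \<notin> {- m..k} \<Longrightarrow> poisson_solution k m x = 0"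
  using k m by (auto simp: poisson_solution_def)

lemma poisson_solution_gradient:
  "poisson_solution k m (x + 1) - poisson_solution k m x =
    (if x < - m then 0
     else if x < 0 then - (real_of_int k + 1) / (2 * real_of_int m)
     else if x < k then (real_of_int k - real_of_int x) / real_of_int k
     else 0)"
proof -
  have km: "real_of_int k > 0" "real_of_int m > 0" using k m by auto
  consider "x < - m" | "x = - m" | "- m < x" "x < 0" | "x = 0" | "0 < x" "x < k" | "x = k" | "k < x"
    using m k by linarith
  then show ?thesis
  proof cases
    case 5
    then have "x + 1 \<le> k" "\<not> x + 1 \<le> 0" "\<not> x \<le> 0" "\<not> x \<le> - m" "\<not> x + 1 \<le> - m" using m by auto
    with 5 km show ?thesis by (simp add: poisson_solution_def field_simps)
  qed (use k m km in \<open>auto simp: poisson_solution_def field_simps\<close>)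
qed

lemma poisson_solution_laplacian:
  "(poisson_solution k m (x + 1) - poisson_solution k m x)
      - (poisson_solution k m x - poisson_solution k m (x - 1))
    = of_bool (x = 0) - of_bool (x \<in> {1..k}) / real_of_int k
      + (real_of_int k + 1) / (2 * real_of_int m) * (of_bool (x = 0) - of_bool (x = - m))"
proof -
  have km: "real_of_int k > 0" "real_of_int m > 0" using k m by auto
  have "poisson_solution k m x - poisson_solution k m (x - 1) =
    (if x - 1 < - m then 0
     else if x - 1 < 0 then - (real_of_int k + 1) / (2 * real_of_int m)
     else if x - 1 < k then (real_of_int k - real_of_int (x - 1)) / real_of_int k
     else 0)"
    using poisson_solution_gradient[of "x - 1"] by simp
  moreover consider "x < - m" | "x = - m" | "- m < x" "x < 0" | "x = 0" | "0 < x" "x < k" | "x = k" | "k < x"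
    using m k by linarith
  ultimately show ?thesis
    unfolding poisson_solution_gradient
    by cases (use k m km in \<open>auto simp: field_simps\<close>)
qed

lemma abs_poisson_solution_le: "\<bar>poisson_solution k m x\<bar> \<le> real_of_int k"
proof -
  have km: "real_of_int k \<ge> 1" "real_of_int m > 0" using k m by auto
  consider "x \<le> - m \<or> k < x" | "- m < x" "x \<le> 0" | "0 < x" "x \<le> k" by linarith
  then show ?thesis
  proof cases
    case 1 with k m show ?thesis by (auto simp: poisson_solution_def)
  next
    case 2
    define r where "r = 1 + real_of_int x / real_of_int m"
    have r: "0 \<le> r" "r \<le> 1"
      using 2 km by (auto simp: r_def field_simps)
    have "\<bar>poisson_solution k m x\<bar> = (real_of_int k + 1) / 2 * r"
      using 2 km r by (simp add: poisson_solution_def r_def[symmetric] abs_mult)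
    also have "\<dots> \<le> (real_of_int k + 1) / 2 * 1"
      using r km by (intro mult_left_mono) auto
    also have "\<dots> \<le> real_of_int k"
      using km by simp
    finally show ?thesis .
  next
    case 3
    define r where "r = real_of_int k - real_of_int x"
    have r: "0 \<le> r" "r \<le> real_of_int k - 1"
      using 3 by (auto simp: r_def)
    have "\<bar>poisson_solution k m x\<bar> = r * (r + 1) / (2 * real_of_int k)"
      using 3 km r by (simp add: poisson_solution_def r_def[symmetric] abs_mult)
    also have "\<dots> \<le> (real_of_int k * real_of_int k) / (2 * real_of_int k)"
      using r km by (intro divide_right_mono mult_mono) auto
    finally show ?thesis using km by simp
  qed
qed

lemma sum_abs_poisson_solution_gradient_le:
  "(\<Sum>x\<in>{- m..k}. \<bar>poisson_solution k m (x + 1) - poisson_solution k m x\<bar>) \<le> 2 * real_of_int k"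
proof -
  have km: "real_of_int k \<ge> 1" "real_of_int m > 0" using k m by auto
  have "(\<Sum>x\<in>{- m..k}. \<bar>poisson_solution k m (x + 1) - poisson_solution k m x\<bar>)
      \<le> (\<Sum>x\<in>{- m..k}. (if x \<in> {- m..<0} then (real_of_int k + 1) / (2 * real_of_int m) else 0)
          + (if x \<in> {0..<k} then 1 else 0))"
    by (rule sum_mono) (use km in \<open>auto simp: poisson_solution_gradient add.commute\<close>)
  also have "\<dots> = (\<Sum>x\<in>{- m..<0}. (real_of_int k + 1) / (2 * real_of_int m)) + (\<Sum>x\<in>{0..<k}. 1)"
  proof -
    have "{- m..k} \<inter> {- m..<0} = {- m..<0}" "{- m..k} \<inter> {0..<k} = {0..<k}"
      using k m by auto
    then show ?thesis
      unfolding sum.distrib by (simp only: sum.inter_restrict[symmetric] finite_atLeastAtMost_int)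
  qed
  also have "\<dots> \<le> 2 * real_of_int k"
    using km m by (simp add: field_simps)
  finally show ?thesis .
qed

end


section \<open>Replacement at the origin\<close>

text \<open>The corrector is \<open>1 / n\<^sup>2\<close> times the sum of the Poisson solution over the particles, with a
  ramp of length \<open>n\<close>. The ramp costs a defect of order \<open>k / n\<close> in the equation. The coefficients have
  total variation of order \<open>k / n\<^sup>2\<close>, so the walker, which jumps at rate of order \<open>n\<close>, also adds at
  most a multiple of \<open>k / n\<close>. In the carre du champ the squared gradients add up to order \<open>k / n\<^sup>4\<close>
  at rate \<open>n\<^sup>2\<close>, and the walker contributes order \<open>k\<^sup>2 / n\<^sup>4\<close> at rate \<open>n\<close>; both are at most of order
  \<open>1 / n\<close>.\<close>

lemma environment_corrector:
  fixes \<alpha> \<beta> :: real and n :: nat and k :: int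
  assumes ab: "\<alpha> \<ge> 0" "\<beta> \<ge> 0" and k: "1 \<le> k" "k \<le> int n"
  obtains f where "local_function f"
    and "\<And>\<xi>. \<bar>f \<xi>\<bar> \<le> 3 * (real_of_int k / real n)"
    and "\<And>\<xi>. \<bar>(of_bool (\<xi> 0) - 1 / real_of_int k * (\<Sum>z = 1..k. of_bool (\<xi> z)))
        - env_generator \<alpha> \<beta> n f \<xi>\<bar> \<le> (1 + 2 * (\<alpha> + \<beta>)) * (real_of_int k / real n)"
    and "\<And>\<xi>. env_generator \<alpha> \<beta> n (\<lambda>\<eta>. (f \<eta>)\<^sup>2) \<xi> - 2 * (f \<xi> * env_generator \<alpha> \<beta> n f \<xi>)
        \<le> (2 + 4 * (\<alpha> + \<beta>)) / real n"
proof
  let ?n = "real n" and ?k = "real_of_int k"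
  define \<phi> where "\<phi> = (\<lambda>x. poisson_solution k (int n) x / ?n\<^sup>2)"
  define A where "A = {- int n..k}"
  define f where "f = occupation_sum \<phi> A"
  have n: "int n \<ge> 1" using k by simp
  have k1: "?k \<ge> 1" and kn: "?k \<le> ?n" and n0: "?n > 0"
    using k by linarith+
  note u = k(1) n
  have A: "finite A" "\<And>x. x \<notin> A \<Longrightarrow> \<phi> x = 0"
    using poisson_solution_outside[OF u] by (auto simp: A_def \<phi>_def)
  have D_eq: "\<phi> (x + 1) - \<phi> x = (poisson_solution k (int n) (x + 1) - poisson_solution k (int n) x) / ?n\<^sup>2" for x
    by (simp add: \<phi>_def diff_divide_distrib)
  have D_off: "\<phi> (x + 1) = \<phi> x" if "x \<notin> A" for x
    using D_eq[of x] that k unfolding poisson_solution_gradient[OF u] by (auto simp: A_def split: if_splits)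
  have D_sum: "(\<Sum>x\<in>A. \<bar>\<phi> (x + 1) - \<phi> x\<bar>) \<le> 2 * ?k / ?n\<^sup>2"
    using sum_abs_poisson_solution_gradient_le[OF u] n0
    by (simp add: A_def D_eq abs_divide sum_divide_distrib[symmetric] divide_right_mono)
  have D_max: "\<bar>\<phi> (x + 1) - \<phi> x\<bar> \<le> 1 / ?n\<^sup>2" for x
    unfolding D_eq poisson_solution_gradient[OF u] abs_divide abs_power2
    by (rule divide_right_mono) (use k1 kn n0 in \<open>auto simp: field_simps\<close>)
  have sh: "\<bar>f (shift_config y \<xi>) - f \<xi>\<bar> \<le> 2 * ?k / ?n\<^sup>2" if "y \<in> {1, -1}" for y \<xi>
    using abs_occupation_sum_shift_le[where \<phi> = \<phi>, OF A A(1) D_off that] D_sum unfolding f_def by (meson order_trans)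
  show "local_function f"
    unfolding f_def by (rule local_function_occupation_sum[OF A(1)])
  show "\<bar>f \<xi>\<bar> \<le> 3 * (?k / ?n)" for \<xi>
  proof -
    have "\<bar>f \<xi>\<bar> \<le> (\<Sum>x\<in>A. \<bar>\<phi> x * of_bool (\<xi> x)\<bar>)"
      unfolding f_def occupation_sum_def by (rule sum_abs)
    also have "\<dots> \<le> (\<Sum>x\<in>A. ?k / ?n\<^sup>2)"
      by (rule sum_mono)
         (use abs_poisson_solution_le[OF u] k1 n0 in \<open>auto simp: \<phi>_def abs_mult divide_right_mono\<close>)
    also have "\<dots> = (?n + ?k + 1) * (?k / ?n\<^sup>2)"
      using k by (simp add: A_def)
    also have "\<dots> \<le> (3 * ?n) * (?k / ?n\<^sup>2)"
      using k1 kn by (intro mult_right_mono) auto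
    also have "\<dots> = 3 * (?k / ?n)"
      using n0 by (simp add: power2_eq_square)
    finally show ?thesis .
  qed
  show "\<bar>(of_bool (\<xi> 0) - 1 / ?k * (\<Sum>z = 1..k. of_bool (\<xi> z))) - env_generator \<alpha> \<beta> n f \<xi>\<bar>
      \<le> (1 + 2 * (\<alpha> + \<beta>)) * (?k / ?n)" for \<xi>
  proof -
    define J where "J = (\<Sum>y\<in>{1, -1}. jump_rate \<alpha> \<beta> y (of_bool (\<xi> 0)) * (f (shift_config y \<xi>) - f \<xi>))"
    define e where "e = (?k + 1) / (2 * ?n) * (of_bool (\<xi> 0) - of_bool (\<xi> (- int n)))"
    have lap: "(\<phi> (x + 1) - \<phi> x) - (\<phi> x - \<phi> (x - 1))
        = (of_bool (x = 0) - of_bool (x \<in> {1..k}) / ?k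
            + (?k + 1) / (2 * ?n) * (of_bool (x = 0) - of_bool (x = - int n))) / ?n\<^sup>2" for x
    proof -
      have "(\<phi> (x + 1) - \<phi> x) - (\<phi> x - \<phi> (x - 1))
          = ((poisson_solution k (int n) (x + 1) - poisson_solution k (int n) x)
              - (poisson_solution k (int n) x - poisson_solution k (int n) (x - 1))) / ?n\<^sup>2"
        by (simp only: \<phi>_def diff_divide_distrib)
      then show ?thesis
        by (simp only: poisson_solution_laplacian[OF u] of_int_of_nat_eq)
    qed
    have "(\<Sum>\<^sub>\<infinity>z\<in>UNIV. f (exchange z \<xi>) - f \<xi>)
        = (\<Sum>x\<in>A. ((\<phi> (x + 1) - \<phi> x) - (\<phi> x - \<phi> (x - 1))) * of_bool (\<xi> x))"
      unfolding f_def
      by (rule exclusion_generator_occupation_sum[where \<phi> = \<phi>, OF A A(1)]) (use k in \<open>auto simp: lap A_def\<close>)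
    also have "\<dots> = (\<Sum>x\<in>A. (of_bool (x = 0) * of_bool (\<xi> x) - of_bool (x \<in> {1..k}) * of_bool (\<xi> x) / ?k
            + (?k + 1) / (2 * ?n) * (of_bool (x = 0) * of_bool (\<xi> x) - of_bool (x = - int n) * of_bool (\<xi> x))) / ?n\<^sup>2)"
      unfolding lap by (intro sum.cong refl) (simp add: algebra_simps add_divide_distrib diff_divide_distrib)
    also have "\<dots> = ((\<Sum>x\<in>A. of_bool (x = 0) * of_bool (\<xi> x)) - (\<Sum>x\<in>A. of_bool (x \<in> {1..k}) * of_bool (\<xi> x)) / ?k
            + (?k + 1) / (2 * ?n) * ((\<Sum>x\<in>A. of_bool (x = 0) * of_bool (\<xi> x)) - (\<Sum>x\<in>A. of_bool (x = - int n) * of_bool (\<xi> x)))) / ?n\<^sup>2"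
      by (simp only: sum_divide_distrib[symmetric] sum.distrib sum_subtractf sum_distrib_left[symmetric])
    also have "(\<Sum>x\<in>A. of_bool (x = 0) * of_bool (\<xi> x)) = (of_bool (\<xi> 0) :: real)"
      using k by (subst sum.mono_neutral_right[of A "{0}"]) (auto simp: A_def)
    also have "(\<Sum>x\<in>A. of_bool (x = - int n) * of_bool (\<xi> x)) = (of_bool (\<xi> (- int n)) :: real)"
      using k by (subst sum.mono_neutral_right[of A "{- int n}"]) (auto simp: A_def)
    also have "(\<Sum>x\<in>A. of_bool (x \<in> {1..k}) * of_bool (\<xi> x)) = (\<Sum>z = 1..k. of_bool (\<xi> z) :: real)"
      using k by (subst sum.mono_neutral_right[of A "{1..k}"]) (auto simp: A_def)
    finally have "?n\<^sup>2 * (\<Sum>\<^sub>\<infinity>z\<in>UNIV. f (exchange z \<xi>) - f \<xi>)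
        = of_bool (\<xi> 0) - 1 / ?k * (\<Sum>z = 1..k. of_bool (\<xi> z)) + e"
      using n0 by (simp add: e_def)
    then have "(of_bool (\<xi> 0) - 1 / ?k * (\<Sum>z = 1..k. of_bool (\<xi> z))) - env_generator \<alpha> \<beta> n f \<xi>
        = - e - ?n * J"
      by (simp add: env_generator_def J_def)
    moreover have "\<bar>e\<bar> \<le> ?k / ?n"
    proof -
      have "\<bar>e\<bar> \<le> (?k + 1) / (2 * ?n) * 1"
        unfolding e_def abs_mult using k1 n0 by (intro mult_mono) auto
      also have "\<dots> \<le> ?k / ?n"
        using k1 n0 by (simp add: field_simps)
      finally show ?thesis .
    qed
    moreover have "?n * \<bar>J\<bar> \<le> 2 * (\<alpha> + \<beta>) * (?k / ?n)"
    proof -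
      have "\<bar>J\<bar> \<le> (\<Sum>y\<in>{1, -1}. \<bar>jump_rate \<alpha> \<beta> y (of_bool (\<xi> 0)) * (f (shift_config y \<xi>) - f \<xi>)\<bar>)"
        unfolding J_def by (rule sum_abs)
      also have "\<dots> = (\<Sum>y\<in>{1, -1}. jump_rate \<alpha> \<beta> y (of_bool (\<xi> 0)) * \<bar>f (shift_config y \<xi>) - f \<xi>\<bar>)"
        by (simp only: abs_mult abs_of_nonneg[OF jump_rate_nonneg[OF ab]])
      also have "\<dots> \<le> (\<alpha> + \<beta>) * (2 * ?k / ?n\<^sup>2)"
        by (rule sum_jump_rate_le[OF ab sh])
      finally have "?n * \<bar>J\<bar> \<le> ?n * ((\<alpha> + \<beta>) * (2 * ?k / ?n\<^sup>2))"
        by (rule mult_left_mono) simp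
      also have "\<dots> = 2 * (\<alpha> + \<beta>) * (?k / ?n)"
        using n0 by (simp add: power2_eq_square)
      finally show ?thesis .
    qed
    moreover have "\<bar>?n * J\<bar> = ?n * \<bar>J\<bar>"
      by (simp add: abs_mult)
    moreover have "(1 + 2 * (\<alpha> + \<beta>)) * (?k / ?n) = ?k / ?n + 2 * (\<alpha> + \<beta>) * (?k / ?n)"
      by (simp only: distrib_right mult_1)
    ultimately show ?thesis by linarith
  qed
  show "env_generator \<alpha> \<beta> n (\<lambda>\<eta>. (f \<eta>)\<^sup>2) \<xi> - 2 * (f \<xi> * env_generator \<alpha> \<beta> n f \<xi>)
      \<le> (2 + 4 * (\<alpha> + \<beta>)) / ?n" for \<xi>
  proof -
    have ex: "f (exchange z \<xi>) - f \<xi> = (\<phi> (z + 1) - \<phi> z) * (of_bool (\<xi> z) - of_bool (\<xi> (z + 1)))" for z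
      unfolding f_def by (rule occupation_sum_exchange[OF A])
    have ex_off: "f (exchange z \<xi>) = f \<xi>" if "z \<notin> A" for z
      using ex[of z] D_off[OF that] by simp
    have "(f (exchange z \<xi>) - f \<xi>)\<^sup>2 \<le> 1 / ?n\<^sup>2 * \<bar>\<phi> (z + 1) - \<phi> z\<bar>" for z
    proof -
      have "(f (exchange z \<xi>) - f \<xi>)\<^sup>2 \<le> \<bar>\<phi> (z + 1) - \<phi> z\<bar> * \<bar>\<phi> (z + 1) - \<phi> z\<bar>"
        unfolding ex by (cases "\<xi> z"; cases "\<xi> (z + 1)")
          (simp_all add: power2_commute[of "\<phi> z"] flip: power2_eq_square)
      also have "\<dots> \<le> 1 / ?n\<^sup>2 * \<bar>\<phi> (z + 1) - \<phi> z\<bar>"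
        by (rule mult_right_mono[OF D_max]) simp
      finally show ?thesis .
    qed
    then have "(\<Sum>z\<in>A. (f (exchange z \<xi>) - f \<xi>)\<^sup>2) \<le> (\<Sum>z\<in>A. 1 / ?n\<^sup>2 * \<bar>\<phi> (z + 1) - \<phi> z\<bar>)"
      by (rule sum_mono)
    also have "\<dots> \<le> 1 / ?n\<^sup>2 * (2 * ?k / ?n\<^sup>2)"
      unfolding sum_distrib_left[symmetric] by (rule mult_left_mono[OF D_sum]) simp
    finally have "?n\<^sup>2 * (\<Sum>z\<in>A. (f (exchange z \<xi>) - f \<xi>)\<^sup>2) \<le> ?n\<^sup>2 * (1 / ?n\<^sup>2 * (2 * ?k / ?n\<^sup>2))"
      by (rule mult_left_mono) simp
    also have "\<dots> = 2 * ?k / ?n\<^sup>2"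
      using n0 by (simp add: power2_eq_square)
    also have "\<dots> \<le> 2 / ?n"
      using kn n0 by (simp add: field_simps power2_eq_square)
    finally have 1: "?n\<^sup>2 * (\<Sum>z\<in>A. (f (exchange z \<xi>) - f \<xi>)\<^sup>2) \<le> 2 / ?n" .
    have "(f (shift_config y \<xi>) - f \<xi>)\<^sup>2 \<le> (2 / ?n)\<^sup>2" if "y \<in> {1, -1}" for y
    proof -
      have "2 * ?k / ?n\<^sup>2 \<le> 2 / ?n"
        using kn n0 by (simp add: field_simps power2_eq_square)
      then have "\<bar>f (shift_config y \<xi>) - f \<xi>\<bar> \<le> \<bar>2 / ?n\<bar>"
        using sh[OF that, of \<xi>] n0 by simp
      then show ?thesis by (simp only: abs_le_square_iff)
    qed
    then have "(\<Sum>y\<in>{1, -1}. jump_rate \<alpha> \<beta> y (of_bool (\<xi> 0)) * (f (shift_config y \<xi>) - f \<xi>)\<^sup>2)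
        \<le> (\<alpha> + \<beta>) * (2 / ?n)\<^sup>2"
      by (rule sum_jump_rate_le[OF ab])
    then have "?n * (\<Sum>y\<in>{1, -1}. jump_rate \<alpha> \<beta> y (of_bool (\<xi> 0)) * (f (shift_config y \<xi>) - f \<xi>)\<^sup>2)
        \<le> ?n * ((\<alpha> + \<beta>) * (2 / ?n)\<^sup>2)"
      by (rule mult_left_mono) simp
    also have "\<dots> = 4 * (\<alpha> + \<beta>) / ?n"
      using n0 by (simp add: power2_eq_square)
    finally have 2: "?n * (\<Sum>y\<in>{1, -1}. jump_rate \<alpha> \<beta> y (of_bool (\<xi> 0)) * (f (shift_config y \<xi>) - f \<xi>)\<^sup>2)
        \<le> 4 * (\<alpha> + \<beta>) / ?n" .
    have "env_generator \<alpha> \<beta> n (\<lambda>\<eta>. (f \<eta>)\<^sup>2) \<xi> - 2 * (f \<xi> * env_generator \<alpha> \<beta> n f \<xi>)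
        = ?n\<^sup>2 * (\<Sum>z\<in>A. (f (exchange z \<xi>) - f \<xi>)\<^sup>2)
          + ?n * (\<Sum>y\<in>{1, -1}. jump_rate \<alpha> \<beta> y (of_bool (\<xi> 0)) * (f (shift_config y \<xi>) - f \<xi>)\<^sup>2)"
      by (rule carre_du_champ[OF A(1) ex_off])
    also have "\<dots> \<le> 2 / ?n + 4 * (\<alpha> + \<beta>) / ?n"
      by (rule add_mono[OF 1 2])
    finally show ?thesis
      by (simp only: add_divide_distrib)
  qed
qed

lemma local_function_in_generator:
  assumes S: "semigroup_generator S = closure (env_pregenerator \<alpha> \<beta> n)" and f: "local_function f"
  shows "(Bcontfun f, Bcontfun (env_generator \<alpha> \<beta> n f)) \<in> semigroup_generator S"
  using env_pregenerator_total[OF f] closure_subset unfolding S by blast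

lemma apply_Bcontfun_local:
  assumes "local_function f"
  shows "apply_bcontfun (Bcontfun f) = f"
    and "apply_bcontfun (Bcontfun (env_generator \<alpha> \<beta> n f)) = env_generator \<alpha> \<beta> n f"
  using local_function_bcontfun[OF assms]
    local_function_bcontfun[OF local_function_env_generator[OF assms]]
  by (simp_all add: Bcontfun_inverse)

text \<open>The corrector is inserted into the general bound for time integrals. With
  \<open>k = \<lfloor>\<epsilon> n\<rfloor>\<close> the first term is of order \<open>\<epsilon>\<close> and the second vanishes as \<open>n\<close> grows.\<close>

lemma replacement_bound:
  fixes \<alpha> \<beta> t :: real and n :: nat and k :: int and X :: "real \<Rightarrow> 'w \<Rightarrow> config"
  assumes ab: "\<alpha> \<ge> 0" "\<beta> \<ge> 0" and k: "1 \<le> k" "k \<le> int n" and t: "t \<ge> 0"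
    and X: "markov_process_with_generator (env_pregenerator \<alpha> \<beta> n) \<mu> M X"
  shows "(\<integral>w. \<bar>LBINT s:{0..t}. (of_bool (X s w 0)
            - 1 / real_of_int k * (\<Sum>z = 1..k. of_bool (X s w z)))\<bar> \<partial>M)
    \<le> (6 + t * (1 + 2 * (\<alpha> + \<beta>))) * (real_of_int k / real n)
      + sqrt (t * ((2 + 4 * (\<alpha> + \<beta>)) / real n))"
proof -
  obtain S where S: "markov_semigroup S" "markov_with_semigroup S M X"
    and gen: "semigroup_generator S = closure (env_pregenerator \<alpha> \<beta> n)"
    and prob: "prob_space M" and meas: "\<forall>t\<ge>0. X t \<in> borel_measurable M"
    and cad: "\<forall>w\<in>space M. cadlag (\<lambda>t. X t w)"
    using X unfolding markov_process_with_generator_def by blast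
  interpret prob_space M by (rule prob)
  interpret markov_process M S X
    by unfold_locales (use S meas cad in auto)
  define V :: "config \<Rightarrow> real" where
    "V = (\<lambda>\<xi>. of_bool (\<xi> 0) - 1 / real_of_int k * (\<Sum>z = 1..k. of_bool (\<xi> z)))"
  have "local_function V"
    unfolding local_function_def V_def by (intro exI[of _ "{0..k}"]) (use k in auto)
  note V = apply_Bcontfun_local(1)[OF this]
  obtain f where f: "local_function f"
    and f_le: "\<And>\<xi>. \<bar>f \<xi>\<bar> \<le> 3 * (real_of_int k / real n)"
    and V_le: "\<And>\<xi>. \<bar>V \<xi> - env_generator \<alpha> \<beta> n f \<xi>\<bar> \<le> (1 + 2 * (\<alpha> + \<beta>)) * (real_of_int k / real n)"
    and cdc: "\<And>\<xi>. env_generator \<alpha> \<beta> n (\<lambda>\<eta>. (f \<eta>)\<^sup>2) \<xi> - 2 * (f \<xi> * env_generator \<alpha> \<beta> n f \<xi>)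
        \<le> (2 + 4 * (\<alpha> + \<beta>)) / real n"
    using environment_corrector[OF ab k] unfolding V_def by metis
  note f2 = local_function_power2[OF f]
  have "(\<integral>w. \<bar>LBINT s:{0..t}. obs (Bcontfun V) s w\<bar> \<partial>M)
      \<le> 2 * (3 * (real_of_int k / real n)) + t * ((1 + 2 * (\<alpha> + \<beta>)) * (real_of_int k / real n))
        + sqrt (t * ((2 + 4 * (\<alpha> + \<beta>)) / real n))"
    by (rule expectation_abs_time_integral_le[OF local_function_in_generator[OF gen f]
          local_function_in_generator[OF gen f2]])
       (simp_all only: apply_Bcontfun_local[OF f] apply_Bcontfun_local[OF f2] V f_le V_le cdc t)
  moreover have "(LBINT s:{0..t}. obs (Bcontfun V) s w)
      = (LBINT s:{0..t}. (of_bool (X s w 0) - 1 / real_of_int k * (\<Sum>z = 1..k. of_bool (X s w z))))" for w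
  proof (rule set_lebesgue_integral_cong)
    have "obs (Bcontfun V) s w
        = of_bool (X s w 0) - 1 / real_of_int k * (\<Sum>z = 1..k. of_bool (X s w z))" if "s \<ge> 0" for s
      unfolding obs_nonneg_time[OF that] V unfolding V_def ..
    then show "\<forall>s. s \<in> {0..t} \<longrightarrow> obs (Bcontfun V) s w
        = of_bool (X s w 0) - 1 / real_of_int k * (\<Sum>z = 1..k. of_bool (X s w z))"
      by simp
  qed simp
  ultimately show ?thesis
    by (simp add: algebra_simps)
qed

theorem theorem3:
  fixes \<alpha> \<beta> \<rho> T :: real
    and u0 :: "real \<Rightarrow> real"
    and M :: "nat \<Rightarrow> 'w measure"
    and \<xi> :: "nat \<Rightarrow> real \<Rightarrow> 'w \<Rightarrow> config"
  assumes "\<alpha> \<ge> 0" and "\<beta> \<ge> 0" and "\<alpha> + \<beta> > 0"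
    and "\<And>x. u0 x \<in> {0..1}"
    and "piecewise_continuous u0"
    and "\<rho> \<in> {0<..<1}"
    and "(SUP n\<in>{1::nat..}. ennreal (1 / real n) *
            (\<Sum>\<^sub>\<infinity>x\<in>(UNIV::int set). ennreal (\<bar>u0 (real_of_int x / real n) - \<rho>\<bar>\<^sup>2))) < \<infinity>"
    and "T > 0"
    and "\<And>n. n \<ge> 1 \<Longrightarrow>
           markov_process_with_generator (env_pregenerator \<alpha> \<beta> n) (bernoulli_profile u0 n) (M n) (\<xi> n)"
  shows "\<forall>t\<in>{0..T}.
    ((\<lambda>\<epsilon>::real. limsup (\<lambda>n. ereal (\<integral>w.
        \<bar>LBINT s:{0..t}. (of_bool (\<xi> n s w 0)
            - 1 / real_of_int \<lfloor>\<epsilon> * real n\<rfloor> * (\<Sum>z = 1..\<lfloor>\<epsilon> * real n\<rfloor>. of_bool (\<xi> n s w z)))\<bar>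
        \<partial>M n)))
      \<longlongrightarrow> 0) (at_right 0)"
proof
  fix t assume "t \<in> {0..T}"
  then have t: "t \<ge> 0" by simp
  define C where "C = 6 + t * (1 + 2 * (\<alpha> + \<beta>))"
  define K where "K = t * (2 + 4 * (\<alpha> + \<beta>))"
  define I where "I = (\<lambda>\<epsilon> n. \<integral>w.
        \<bar>LBINT s:{0..t}. (of_bool (\<xi> n s w 0)
            - 1 / real_of_int \<lfloor>\<epsilon> * real n\<rfloor> * (\<Sum>z = 1..\<lfloor>\<epsilon> * real n\<rfloor>. of_bool (\<xi> n s w z)))\<bar>
        \<partial>M n)"
  have C: "C \<ge> 0" using t assms(1-3) by (simp add: C_def)
  have limsup_le: "limsup (\<lambda>n. ereal (I \<epsilon> n)) \<le> ereal (C * \<epsilon>)" if \<epsilon>: "0 < \<epsilon>" "\<epsilon> < 1" for \<epsilon>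
  proof -
    have "\<forall>\<^sub>F n in sequentially. I \<epsilon> n \<le> C * \<epsilon> + sqrt (K / real n)"
      \<comment> \<open>From this index on the window \<open>{1..\<lfloor>\<epsilon> n\<rfloor>}\<close> is nonempty.\<close>
      using eventually_ge_at_top[of "nat \<lceil>1 / \<epsilon>\<rceil>"]
    proof eventually_elim
      case (elim n)
      then have "1 / \<epsilon> \<le> real n" by linarith
      then have en: "1 \<le> \<epsilon> * real n" using \<epsilon> by (simp add: field_simps)
      then have n: "n \<ge> 1" by (cases n) auto
      have "\<epsilon> * real n \<le> 1 * real n"
        using \<epsilon> by (intro mult_right_mono) auto
      then have k: "1 \<le> \<lfloor>\<epsilon> * real n\<rfloor>" "\<lfloor>\<epsilon> * real n\<rfloor> \<le> int n"
        using en by linarith+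
      have "real_of_int \<lfloor>\<epsilon> * real n\<rfloor> / real n \<le> \<epsilon>"
        using n by (simp add: divide_le_eq)
      then have "C * (real_of_int \<lfloor>\<epsilon> * real n\<rfloor> / real n) \<le> C * \<epsilon>"
        using C by (rule mult_left_mono)
      with replacement_bound[OF assms(1,2) k t assms(9)[OF n]]
      show ?case
        unfolding I_def C_def K_def by simp
    qed
    then have "limsup (\<lambda>n. ereal (I \<epsilon> n)) \<le> limsup (\<lambda>n. ereal (C * \<epsilon> + sqrt (K / real n)))"
      by (intro Limsup_mono) (simp add: eventually_mono)
    also have "\<dots> = ereal (C * \<epsilon>)"
    proof (rule lim_imp_Limsup)
      have "(\<lambda>n. C * \<epsilon> + sqrt (K / real n)) \<longlonglongrightarrow> C * \<epsilon> + sqrt 0"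
        by (intro tendsto_intros lim_const_over_n)
      then show "(\<lambda>n. ereal (C * \<epsilon> + sqrt (K / real n))) \<longlonglongrightarrow> ereal (C * \<epsilon>)"
        by simp
    qed simp
    finally show ?thesis .
  qed
  have "((\<lambda>\<epsilon>. limsup (\<lambda>n. ereal (I \<epsilon> n))) \<longlongrightarrow> 0) (at_right 0)"
  proof (rule tendsto_sandwich)
    show "\<forall>\<^sub>F \<epsilon> in at_right 0. 0 \<le> limsup (\<lambda>n. ereal (I \<epsilon> n))"
      by (intro always_eventually allI le_Limsup) (auto simp: I_def)
    show "\<forall>\<^sub>F \<epsilon> in at_right 0. limsup (\<lambda>n. ereal (I \<epsilon> n)) \<le> ereal (C * \<epsilon>)"
      unfolding eventually_at_right_field using limsup_le by (intro exI[of _ 1]) auto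
    have "((\<lambda>\<epsilon>. C * \<epsilon>) \<longlongrightarrow> C * 0) (at_right 0)"
      by (intro tendsto_intros)
    then show "((\<lambda>\<epsilon>. ereal (C * \<epsilon>)) \<longlongrightarrow> 0) (at_right 0)"
      by (simp add: zero_ereal_def)
  qed simp
  then show "((\<lambda>\<epsilon>::real. limsup (\<lambda>n. ereal (\<integral>w.
        \<bar>LBINT s:{0..t}. (of_bool (\<xi> n s w 0)
            - 1 / real_of_int \<lfloor>\<epsilon> * real n\<rfloor> * (\<Sum>z = 1..\<lfloor>\<epsilon> * real n\<rfloor>. of_bool (\<xi> n s w z)))\<bar>
        \<partial>M n)))
      \<longlongrightarrow> 0) (at_right 0)"
    unfolding I_def .
qed

end
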